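(* Let $n,k$ be positive integers. Let $f_{n,k}=f_1\times\cdots\times f_k$ be the product function in which every $f_i$ equals $\oplus^2_{2^n}:\mathbb{Z}_{2^n}^2\times\mathbb{Z}_{2^n}^2\to\mathbb{Z}_{2^n}^2$, $(q,r)\oplus^2_{2^n}(s,t)=(q+s\bmod 2^n, r+t\bmod 2^n)$; thus $f_{n,k}$ has $2k$ inputs, the inputs of $f_i$ being those of senders $2i-1$ and $2i$, and its output is the $k$-tuple of values of the $f_i$. Let $\vec n'=(2^n,\dots,2^n)$ be the vector of length $2k$ with all entries $2^n$. Then $$P_S^{f_{n,k}}(\mathbf Q^{P\text{-}E}(\vec n'))=1>\Big(\frac1{2^n}\Big)^k\ge\max\big\{P_S^{f_{n,k}}(\mathbf Q(\vec n')),\,P_S^{f_{n,k}}(\mathbf C^{P\text{-}N}(\vec n'))\big\}\ge P_S^{f_{n,k}}(\mathbf C^{P\text{-}E}(\vec n'))\ge P_S^{f_{n,k}}(\mathbf C(\vec n')).$$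
   Context: All Hilbert spaces are finite-dimensional. There are $2k$ senders with finite input alphabets $\mathcal W_1,\dots,\mathcal W_{2k}$, one receiver with finite output alphabet $\mathcal Z$, and $\vec d=(d_1,\dots,d_{2k})$ a vector of positive integers. The following are sets of conditional distributions $Q(z|w_1,\dots,w_{2k})$; classical messages $c_i$ range over $\{0,\dots,d_i-1\}$: - $\mathbf C(\vec d)$: $Q(z|w)=\sum_{c}R(z|c_1,\dots,c_{2k})\prod_{i=1}^{2k}P_i(c_i|w_i)$ for conditional distributions $P_i$, $R$. - $\mathbf Q(\vec d)$: $Q(z|w)=\mathrm{Tr}[\Pi_z\bigotimes_{i=1}^{2k}\rho_i^{w_i}]$ with states $\rho_i^{w_i}$ on $\mathbb C^{d_i}$ and a POVM $\{\Pi_z\}$ on $\bigotimes_i\mathbb C^{d_i}$. - $\mathbf C^{P\text{-}N}(\vec d)$ (pairwise nonsignaling-assisted): $Q(z|w)=\sum_cR(z|c)\prod_{i=1}^kN_i(c_{2i-1},c_{2i}|w_{2i-1},w_{2i})$ with each $N_i$ a bipartite nonsignaling conditional distribution (each output's marginal independent of the other party's input). - $\mathbf C^{P\text{-}E}(\vec d)$ (pairwise entanglement-assisted classical): as $\mathbf C^{P\text{-}N}$, with each $N_i$ obtained from local measurements on a bipartite quantum state shared by senders $2i-1$ and $2i$: $N_i(a,b|w,w')=\mathrm{Tr}[(M^{w}_a\otimes M'^{w'}_b)\rho_i]$ with POVMs $\{M^w_a\}_a,\{M'^{w'}_b\}_b$. - $\mathbf Q^{P\text{-}E}(\vec d)$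 (pairwise entanglement-assisted quantum): $Q(z|w)=\mathrm{Tr}\big[\Pi_z\bigotimes_{i=1}^k(\mathcal E_{2i-1}^{w_{2i-1}}\otimes\mathcal E_{2i}^{w_{2i}})(\rho_i)\big]$, where $\rho_i$ is a bipartite state shared by senders $2i-1$ and $2i$, $\mathcal E_j^{w_j}$ is a quantum channel from sender $j$'s share to $\mathbb C^{d_j}$, and $\{\Pi_z\}$ is a POVM on $\bigotimes_j\mathbb C^{d_j}$. For $f:\mathcal W_1\times\cdots\times\mathcal W_{2k}\to\mathcal Z$, $P_S^f(Q)=\frac{1}{\prod_i|\mathcal W_i|}\sum_wQ(f(w)|w)$ and $P_S^f(\mathbf S)=\sup_{Q\in\mathbf S}P_S^f(Q)$. *)

theory Defs
  imports "HOL-Library.FuncSet" "Jordan_Normal_Form.Matrix"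
begin

text \<open>
  Conventions. The \<open>2k\<close> senders are numbered \<open>0, \<dots>, 2k-1\<close>; the \<open>i\<close>-th pair
  (\<open>i < k\<close>) consists of senders \<open>2i\<close> and \<open>2i+1\<close>. Input strings \<open>w\<close> and message strings
  \<open>c\<close> are elements of the dependent product \<open>PiE {..<2*k}\<close>. A conditional distribution
  \<open>P(y|x)\<close> is written \<open>P y x\<close>. The Hilbert space \<open>\<complex>\<^sup>D\<close> is represented by its dimension
  \<open>D\<close>, operators on it by elements of \<open>carrier_mat D D\<close>, and tensor products by
  Kronecker products.
\<close>

definition mat_trace :: "complex mat \<Rightarrow> complex" where
  "mat_trace A = (\<Sum>i<dim_row A. A $$ (i, i))"

text \<open>The order on \<^typ>\<open>complex\<close> is such that \<open>0 \<le> z\<close> means that \<open>z\<close> is real and nonnegative;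
  hence the condition below includes that \<open>A\<close> is Hermitian.\<close>

definition psd :: "nat \<Rightarrow> complex mat \<Rightarrow> bool" where
  "psd D A \<longleftrightarrow> A \<in> carrier_mat D D \<and> (\<forall>v \<in> carrier_vec D. 0 \<le> (A *\<^sub>v v) \<bullet>c v)"

definition density :: "nat \<Rightarrow> complex mat \<Rightarrow> bool" where
  "density D \<rho> \<longleftrightarrow> psd D \<rho> \<and> mat_trace \<rho> = 1"

definition povm :: "nat \<Rightarrow> 'a set \<Rightarrow> ('a \<Rightarrow> complex mat) \<Rightarrow> bool" where
  "povm D A M \<longleftrightarrow> (\<forall>a\<in>A. psd D (M a)) \<and> mat D D (\<lambda>ij. \<Sum>a\<in>A. M a $$ ij) = 1\<^sub>m D"

definition kron :: "complex mat \<Rightarrow> complex mat \<Rightarrow> complex mat" where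
  "kron A B = mat (dim_row A * dim_row B) (dim_col A * dim_col B)
     (\<lambda>(i, j). A $$ (i div dim_row B, j div dim_col B) * B $$ (i mod dim_row B, j mod dim_col B))"

primrec tensor :: "nat \<Rightarrow> (nat \<Rightarrow> complex mat) \<Rightarrow> complex mat" where
  "tensor 0 A = 1\<^sub>m 1"
| "tensor (Suc m) A = kron (tensor m A) (A m)"

definition matrix_unit :: "nat \<Rightarrow> nat \<Rightarrow> nat \<Rightarrow> complex mat" where
  "matrix_unit D a b = mat D D (\<lambda>(i, j). if i = a \<and> j = b then 1 else 0)"

text \<open>For linear maps \<open>E\<close> (from operators on \<open>\<complex>\<^sup>D\<close> to operators on \<open>\<complex>\<^sup>d\<close>) and \<open>F\<close> (from
  \<open>\<complex>\<^sup>D\<^sup>'\<close> to \<open>\<complex>\<^sup>d\<^sup>'\<close>), \<open>map_tensor D D' d d' E F\<close> is the linear map \<open>E \<otimes> F\<close>, i.e. the linear extension of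
  \<open>X \<otimes> Y \<mapsto> E(X) \<otimes> F(Y)\<close>, obtained by expanding the argument in the basis of products
  of matrix units. The entry of \<open>X\<close> at row \<open>a * D' + b\<close> and column \<open>a' * D' + b'\<close> is its
  coefficient at \<open>|a\<rangle>\<langle>a'| \<otimes> |b\<rangle>\<langle>b'|\<close>.\<close>

definition map_tensor :: "nat \<Rightarrow> nat \<Rightarrow> nat \<Rightarrow> nat \<Rightarrow> (complex mat \<Rightarrow> complex mat) \<Rightarrow>
    (complex mat \<Rightarrow> complex mat) \<Rightarrow> complex mat \<Rightarrow> complex mat" where
  "map_tensor D D' d d' E F X = mat (d * d') (d * d') (\<lambda>ij.
     \<Sum>a<D. \<Sum>a'<D. \<Sum>b<D'. \<Sum>b'<D'. X $$ (a * D' + b, a' * D' + b') *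
       kron (E (matrix_unit D a a')) (F (matrix_unit D' b b')) $$ ij)"

definition linear_on_mat :: "nat \<Rightarrow> nat \<Rightarrow> (complex mat \<Rightarrow> complex mat) \<Rightarrow> bool" where
  "linear_on_mat D d E \<longleftrightarrow>
     (\<forall>X \<in> carrier_mat D D. E X \<in> carrier_mat d d) \<and>
     (\<forall>X \<in> carrier_mat D D. \<forall>Y \<in> carrier_mat D D. E (X + Y) = E X + E Y) \<and>
     (\<forall>x. \<forall>X \<in> carrier_mat D D. E (x \<cdot>\<^sub>m X) = x \<cdot>\<^sub>m E X)"

definition completely_positive :: "nat \<Rightarrow> nat \<Rightarrow> (complex mat \<Rightarrow> complex mat) \<Rightarrow> bool" where
  "completely_positive D d E \<longleftrightarrow>
     (\<forall>m X. psd (D * m) X \<longrightarrow> psd (d * m) (map_tensor D m d m E (\<lambda>Y. Y) X))"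

definition trace_preserving :: "nat \<Rightarrow> (complex mat \<Rightarrow> complex mat) \<Rightarrow> bool" where
  "trace_preserving D E \<longleftrightarrow> (\<forall>X \<in> carrier_mat D D. mat_trace (E X) = mat_trace X)"

definition quantum_channel :: "nat \<Rightarrow> nat \<Rightarrow> (complex mat \<Rightarrow> complex mat) \<Rightarrow> bool" where
  "quantum_channel D d E \<longleftrightarrow>
     linear_on_mat D d E \<and> completely_positive D d E \<and> trace_preserving D E"

definition cond_dist :: "'x set \<Rightarrow> 'y set \<Rightarrow> ('y \<Rightarrow> 'x \<Rightarrow> real) \<Rightarrow> bool" where
  "cond_dist X Y P \<longleftrightarrow> (\<forall>x\<in>X. (\<forall>y\<in>Y. 0 \<le> P y x) \<and> (\<Sum>y\<in>Y. P y x) = 1)"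

definition nonsignaling ::
    "'x set \<Rightarrow> 'y set \<Rightarrow> 'a set \<Rightarrow> 'b set \<Rightarrow> ('a \<Rightarrow> 'b \<Rightarrow> 'x \<Rightarrow> 'y \<Rightarrow> real) \<Rightarrow> bool" where
  "nonsignaling X Y A B N \<longleftrightarrow>
     cond_dist (X \<times> Y) (A \<times> B) (\<lambda>(a, b) (x, y). N a b x y) \<and>
     (\<forall>a\<in>A. \<forall>x\<in>X. \<forall>y\<in>Y. \<forall>y'\<in>Y. (\<Sum>b\<in>B. N a b x y) = (\<Sum>b\<in>B. N a b x y')) \<and>
     (\<forall>b\<in>B. \<forall>y\<in>Y. \<forall>x\<in>X. \<forall>x'\<in>X. (\<Sum>a\<in>A. N a b x y) = (\<Sum>a\<in>A. N a b x' y))"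

definition quantum_correlation ::
    "'x set \<Rightarrow> 'y set \<Rightarrow> 'a set \<Rightarrow> 'b set \<Rightarrow> ('a \<Rightarrow> 'b \<Rightarrow> 'x \<Rightarrow> 'y \<Rightarrow> real) \<Rightarrow> bool" where
  "quantum_correlation X Y A B N \<longleftrightarrow>
     (\<exists>D D' \<rho> M M'. density (D * D') \<rho> \<and>
        (\<forall>x\<in>X. povm D A (\<lambda>a. M a x)) \<and> (\<forall>y\<in>Y. povm D' B (\<lambda>b. M' b y)) \<and>
        (\<forall>a\<in>A. \<forall>b\<in>B. \<forall>x\<in>X. \<forall>y\<in>Y.
           complex_of_real (N a b x y) = mat_trace (kron (M a x) (M' b y) * \<rho>)))"

text \<open>Only the values \<open>Q z w\<close> with \<open>z \<in> Z\<close> and \<open>w \<in> strings k W\<close> are meaningful; the sets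
  below leave the other values of \<open>Q\<close> unconstrained.\<close>

definition strings :: "nat \<Rightarrow> (nat \<Rightarrow> 'a set) \<Rightarrow> (nat \<Rightarrow> 'a) set" where
  "strings k W = PiE {..<2 * k} W"

abbreviation messages :: "nat \<Rightarrow> (nat \<Rightarrow> nat) \<Rightarrow> (nat \<Rightarrow> nat) set" where
  "messages k d \<equiv> strings k (\<lambda>j. {..<d j})"

definition set_C :: "nat \<Rightarrow> (nat \<Rightarrow> 'w set) \<Rightarrow> 'z set \<Rightarrow> (nat \<Rightarrow> nat) \<Rightarrow>
    ('z \<Rightarrow> (nat \<Rightarrow> 'w) \<Rightarrow> real) set" where
  "set_C k W Z d = {Q. \<exists>R P.
     cond_dist (messages k d) Z R \<and>
     (\<forall>j<2 * k. cond_dist (W j) {..<d j} (P j)) \<and>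
     (\<forall>z\<in>Z. \<forall>w \<in> strings k W.
        Q z w = (\<Sum>c \<in> messages k d. R z c * (\<Prod>j<2 * k. P j (c j) (w j))))}"

definition set_Q :: "nat \<Rightarrow> (nat \<Rightarrow> 'w set) \<Rightarrow> 'z set \<Rightarrow> (nat \<Rightarrow> nat) \<Rightarrow>
    ('z \<Rightarrow> (nat \<Rightarrow> 'w) \<Rightarrow> real) set" where
  "set_Q k W Z d = {Q. \<exists>M \<rho>.
     povm (\<Prod>j<2 * k. d j) Z M \<and>
     (\<forall>j<2 * k. \<forall>x\<in>W j. density (d j) (\<rho> j x)) \<and>
     (\<forall>z\<in>Z. \<forall>w \<in> strings k W.
        complex_of_real (Q z w) = mat_trace (M z * tensor (2 * k) (\<lambda>j. \<rho> j (w j))))}"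

definition set_CPN :: "nat \<Rightarrow> (nat \<Rightarrow> 'w set) \<Rightarrow> 'z set \<Rightarrow> (nat \<Rightarrow> nat) \<Rightarrow>
    ('z \<Rightarrow> (nat \<Rightarrow> 'w) \<Rightarrow> real) set" where
  "set_CPN k W Z d = {Q. \<exists>R N.
     cond_dist (messages k d) Z R \<and>
     (\<forall>i<k. nonsignaling (W (2 * i)) (W (2 * i + 1)) {..<d (2 * i)} {..<d (2 * i + 1)} (N i)) \<and>
     (\<forall>z\<in>Z. \<forall>w \<in> strings k W.
        Q z w = (\<Sum>c \<in> messages k d. R z c *
          (\<Prod>i<k. N i (c (2 * i)) (c (2 * i + 1)) (w (2 * i)) (w (2 * i + 1)))))}"

definition set_CPE :: "nat \<Rightarrow> (nat \<Rightarrow> 'w set) \<Rightarrow> 'z set \<Rightarrow> (nat \<Rightarrow> nat) \<Rightarrow>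
    ('z \<Rightarrow> (nat \<Rightarrow> 'w) \<Rightarrow> real) set" where
  "set_CPE k W Z d = {Q. \<exists>R N.
     cond_dist (messages k d) Z R \<and>
     (\<forall>i<k. quantum_correlation (W (2 * i)) (W (2 * i + 1))
        {..<d (2 * i)} {..<d (2 * i + 1)} (N i)) \<and>
     (\<forall>z\<in>Z. \<forall>w \<in> strings k W.
        Q z w = (\<Sum>c \<in> messages k d. R z c *
          (\<Prod>i<k. N i (c (2 * i)) (c (2 * i + 1)) (w (2 * i)) (w (2 * i + 1)))))}"

text \<open>In \<open>set_QPE\<close>, \<open>D j\<close> is the dimension of sender \<open>j\<close>'s share of the state of its pair;
  it is not bounded in terms of \<open>d\<close>.\<close>

definition set_QPE :: "nat \<Rightarrow> (nat \<Rightarrow> 'w set) \<Rightarrow> 'z set \<Rightarrow> (nat \<Rightarrow> nat) \<Rightarrow>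
    ('z \<Rightarrow> (nat \<Rightarrow> 'w) \<Rightarrow> real) set" where
  "set_QPE k W Z d = {Q. \<exists>M D \<rho> E.
     povm (\<Prod>j<2 * k. d j) Z M \<and>
     (\<forall>i<k. density (D (2 * i) * D (2 * i + 1)) (\<rho> i)) \<and>
     (\<forall>j<2 * k. \<forall>x\<in>W j. quantum_channel (D j) (d j) (E j x)) \<and>
     (\<forall>z\<in>Z. \<forall>w \<in> strings k W.
        complex_of_real (Q z w) = mat_trace (M z * tensor k (\<lambda>i.
          map_tensor (D (2 * i)) (D (2 * i + 1)) (d (2 * i)) (d (2 * i + 1))
            (E (2 * i) (w (2 * i))) (E (2 * i + 1) (w (2 * i + 1))) (\<rho> i))))}"

definition success_prob :: "nat \<Rightarrow> (nat \<Rightarrow> 'w set) \<Rightarrow> ((nat \<Rightarrow> 'w) \<Rightarrow> 'z) \<Rightarrow>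
    ('z \<Rightarrow> (nat \<Rightarrow> 'w) \<Rightarrow> real) \<Rightarrow> real" where
  "success_prob k W f Q =
     1 / (\<Prod>j<2 * k. real (card (W j))) * (\<Sum>w \<in> strings k W. Q (f w) w)"

definition max_success_prob :: "nat \<Rightarrow> (nat \<Rightarrow> 'w set) \<Rightarrow> ((nat \<Rightarrow> 'w) \<Rightarrow> 'z) \<Rightarrow>
    ('z \<Rightarrow> (nat \<Rightarrow> 'w) \<Rightarrow> real) set \<Rightarrow> real" where
  "max_success_prob k W f S = (SUP Q\<in>S. success_prob k W f Q)"

text \<open>\<open>\<int>\<^sub>m\<close> is represented by \<open>{..<m}\<close> with addition modulo \<open>m\<close>.\<close>

definition Zmod2 :: "nat \<Rightarrow> (nat \<times> nat) set" where
  "Zmod2 m = {..<m} \<times> {..<m}"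

definition oplus2 :: "nat \<Rightarrow> nat \<times> nat \<Rightarrow> nat \<times> nat \<Rightarrow> nat \<times> nat" where
  "oplus2 m = (\<lambda>(q, r) (s, t). ((q + s) mod m, (r + t) mod m))"

definition product_fun ::
    "nat \<Rightarrow> (nat \<Rightarrow> 'w \<Rightarrow> 'w \<Rightarrow> 'z) \<Rightarrow> (nat \<Rightarrow> 'w) \<Rightarrow> (nat \<Rightarrow> 'z)" where
  "product_fun k g w = (\<lambda>i\<in>{..<k}. g i (w (2 * i)) (w (2 * i + 1)))"

end

theory Submission
  imports Defs "HOL-Analysis.L2_Norm"
begin

text \<open>
  Value 1 for shared entanglement is superdense coding: both senders of a pair apply generalized
  Pauli matrices to a maximally entangled state, and the resulting Bell states, labelled by the sum
  of the two inputs, are orthogonal. For the upper bounds, fix the inputs of the second senders.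
  Each output is then correct for exactly one choice of inputs of the first senders, so it suffices
  to bound the probability of each output by a quantity that does not depend on the latter inputs
  and whose sum over the outputs is \<open>2\<^sup>n\<^sup>k\<close>. Without entanglement this is achieved by replacing the
  states of the first senders by the identity, which dominates them; with nonsignaling assistance,
  by replacing each \<open>N\<^sub>i\<close> by its marginal for the second sender.
\<close>

section \<open>Positive semidefinite matrices\<close>

text \<open>Write \<open>m\<close> for 2^n. The value \<open>(1 / m) ^ k\<close> comes from a count:
  the second senders have \<open>m^(2k)\<close> joint inputs, each of them contributes at most
  \<open>m^k\<close>, and the average runs over \<open>m^(4k)\<close> inputs. The factor
  \<open>m^k\<close> is, in one case, the trace of a tensor product containing \<open>k\<close>
  identities of size \<open>m\<close>; in the other, it is the number of message tuples of the first
  senders, which remain free once their outputs have been summed out of each \<open>N i\<close>.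
  Three facts carry the operator part: a state is dominated by the identity, the trace of a product
  of positive matrices is nonnegative, and tensor products of positive matrices are positive. All
  three rest on writing a positive semidefinite matrix as a sum of rank-one terms, obtained by
  elimination on the entries rather than from eigenvectors. Comparing suprema of reals also needs
  nonempty sets and bounded values. A constant strategy shows nonemptiness, and the inclusions hand
  the bound for nonsignaling assistance down to the two smaller classical sets.\<close>

lemma complex_nonneg_iff: "0 \<le> (z::complex) \<longleftrightarrow> 0 \<le> Re z \<and> Im z = 0"
  by (auto simp: less_eq_complex_def)

lemma cnj_mult_self_nonneg: "0 \<le> cnj z * z" "0 \<le> z * cnj z"
  by (simp_all add: complex_nonneg_iff)

lemma complex_sum_nonneg:
  fixes f :: "'a \<Rightarrow> complex"
  shows "(\<And>x. x \<in> A \<Longrightarrow> 0 \<le> f x) \<Longrightarrow> 0 \<le> sum f A"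
  by (auto simp: complex_nonneg_iff intro!: sum_nonneg)

text \<open>Coefficients and vectors are plain functions, so that Schur complements and
  one-coordinate updates can be inserted without building matrices. Values at indices from
  \<open>D\<close> on do not enter.\<close>

definition form :: "nat \<Rightarrow> (nat \<Rightarrow> nat \<Rightarrow> complex) \<Rightarrow> (nat \<Rightarrow> complex) \<Rightarrow> complex" where
  "form D a v = (\<Sum>i<D. \<Sum>j<D. cnj (v i) * a i j * v j)"

lemma psd_iff:
  "psd D A \<longleftrightarrow> A \<in> carrier_mat D D \<and> (\<forall>v. 0 \<le> form D (\<lambda>i j. A $$ (i, j)) v)"
proof -
  have eq: "(A *\<^sub>v v) \<bullet>c v = form D (\<lambda>i j. A $$ (i, j)) (vec_index v)"
    if "A \<in> carrier_mat D D" "v \<in> carrier_vec D" for v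
    using that
    by (auto simp: scalar_prod_def form_def sum_distrib_right lessThan_atLeast0 row_def
        intro!: sum.cong)
  have eq': "form D a (vec_index (vec D v)) = form D a v" for a v
    by (simp add: form_def)
  show ?thesis
    unfolding psd_def by (metis eq eq' vec_carrier)
qed

lemma psd_carrier: "psd D A \<Longrightarrow> A \<in> carrier_mat D D"
  by (simp add: psd_def)

text \<open>Expansion at \<open>v\<close> plus \<open>s\<close> times the basis vector
  \<open>p\<close>. Diagonal signs, Hermitian symmetry, vanishing rows and the Schur complement all
  follow from suitable choices of \<open>v\<close> and \<open>s\<close>.\<close>

lemma form_update:
  assumes "p < D"
  shows "form D a (v(p := v p + s)) =
    form D a v + cnj s * (\<Sum>j<D. a p j * v j) + s * (\<Sum>i<D. cnj (v i) * a i p) + cnj s * s * a p p"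
proof -
  let ?e = "\<lambda>i. if i = p then s else 0"
  have v: "v(p := v p + s) = (\<lambda>i. v i + ?e i)" by auto
  have "form D a (v(p := v p + s)) = form D a v + (\<Sum>i<D. \<Sum>j<D. cnj (?e i) * a i j * v j)
      + (\<Sum>i<D. \<Sum>j<D. cnj (v i) * a i j * ?e j) + (\<Sum>i<D. \<Sum>j<D. cnj (?e i) * a i j * ?e j)"
    unfolding v form_def by (simp add: algebra_simps sum.distrib)
  moreover have "(\<Sum>i<D. \<Sum>j<D. cnj (?e i) * a i j * v j) = cnj s * (\<Sum>j<D. a p j * v j)"
  proof -
    have "(\<Sum>i<D. \<Sum>j<D. cnj (?e i) * a i j * v j) =
        (\<Sum>i<D. if i = p then cnj s * (\<Sum>j<D. a p j * v j) else 0)"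
      by (intro sum.cong) (auto simp: sum_distrib_left mult.assoc)
    then show ?thesis using assms by simp
  qed
  moreover have "(\<Sum>i<D. \<Sum>j<D. cnj (v i) * a i j * ?e j) = s * (\<Sum>i<D. cnj (v i) * a i p)"
    using assms by (simp add: if_distrib[of "\<lambda>x. _ * x"] sum_distrib_left mult_ac cong: if_cong)
  moreover have "(\<Sum>i<D. \<Sum>j<D. cnj (?e i) * a i j * ?e j) = cnj s * s * a p p"
  proof -
    have "(\<Sum>i<D. \<Sum>j<D. cnj (?e i) * a i j * ?e j) = (\<Sum>i<D. cnj (?e i) * a i p * s)"
      using assms by (simp add: if_distrib[of "\<lambda>x. _ * x"] cong: if_cong)
    also have "\<dots> = (\<Sum>i<D. if i = p then cnj s * a p p * s else 0)"
      by (intro sum.cong) auto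
    finally show ?thesis using assms by (simp add: mult_ac)
  qed
  ultimately show ?thesis by simp
qed

lemma form_unit_update:
  assumes "i < D" "p < D"
  shows "form D a ((\<lambda>j. if j = i then 1 else 0)(p := (if p = i then 1 else 0) + s)) =
    a i i + cnj s * a p i + s * a i p + cnj s * s * a p p"
proof -
  let ?e = "(\<lambda>j. if j = i then 1 else 0) :: nat \<Rightarrow> complex"
  have "form D a ?e = (\<Sum>k<D. if k = i then a i i else 0)"
    unfolding form_def using assms
    by (intro sum.cong refl) (simp add: if_distrib[of "\<lambda>x. _ * x"] cong: if_cong)
  then have "form D a ?e = a i i" using assms by simp
  moreover have "(\<Sum>j<D. a p j * ?e j) = a p i"
    using assms by (simp add: if_distrib[of "\<lambda>x. _ * x"] cong: if_cong)
  moreover have "(\<Sum>j<D. cnj (?e j) * a j p) = (\<Sum>j<D. if j = i then a i p else 0)"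
    by (intro sum.cong) auto
  ultimately show ?thesis
    using form_update[OF assms(2), of a ?e s] assms by simp
qed

context
  fixes D :: nat and a :: "nat \<Rightarrow> nat \<Rightarrow> complex"
  assumes pos: "0 \<le> form D a v"
begin

lemma pos_form_diag: "i < D \<Longrightarrow> 0 \<le> a i i"
  using pos form_unit_update[of i D i a 0] by (metis (no_types, lifting) add.right_neutral complex_cnj_zero mult_zero_left)

lemma pos_form_hermitian:
  assumes "i < D" "j < D"
  shows "a j i = cnj (a i j)"
proof -
  have d: "Im (a i i) = 0" "Im (a j j) = 0"
    using pos_form_diag assms by (simp_all add: complex_nonneg_iff)
  have "0 \<le> a i i + cnj s * a j i + s * a i j + cnj s * s * a j j" for s
    using pos form_unit_update[OF assms, of a s] by metis
  \<comment> \<open>The form is real at both vectors: \<open>s = 1\<close> makes the imaginary parts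
    of \<open>a i j\<close> and \<open>a j i\<close> cancel, and \<open>s = \<i>\<close> makes their
    real parts agree.\<close>
  from this[of 1] this[of \<i>] d show ?thesis
    by (simp add: complex_nonneg_iff complex_eq_iff)
qed

text \<open>When \<open>a p p = 0\<close> the expansion has no quadratic term in \<open>s\<close>,
  and a real affine function that stays nonnegative is constant. The direction
  \<open>s = - t * a p i\<close> exposes the slope, a multiple of the squared modulus of
  \<open>a p i\<close>.\<close>

lemma pos_form_zero_diag:
  assumes "i < D" "p < D" "a p p = 0"
  shows "a p i = 0" "a i p = 0"
proof -
  have h: "a i p = cnj (a p i)" using assms by (intro pos_form_hermitian)
  have *: "0 \<le> a i i + cnj s * a p i + s * a i p" for s
    using pos form_unit_update[OF assms(1,2), of a s] assms(3) by (metis add.right_neutral mult_zero_right)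
  define c where "c = (cmod (a p i))\<^sup>2"
  have ineq: "0 \<le> Re (a i i) - 2 * t * c" for t :: real
  proof -
    have "cnj (- of_real t * a p i) * a p i + (- of_real t * a p i) * a i p = of_real (- 2 * t * c)"
      unfolding h c_def cmod_power2 by (simp add: complex_eq_iff power2_eq_square algebra_simps)
    with *[of "- of_real t * a p i"] have "0 \<le> a i i + of_real (- 2 * t * c)"
      by (simp only: add.assoc)
    then show ?thesis by (simp add: complex_nonneg_iff)
  qed
  have "c = 0"
  proof (rule ccontr)
    assume "c \<noteq> 0"
    \<comment> \<open>For this \<open>t\<close> the affine function takes the value
      \<open>-1\<close>.\<close>
    with ineq[of "(Re (a i i) + 1) / (2 * c)"] show False by simp
  qed
  then show "a p i = 0" "a i p = 0" by (simp_all add: c_def h)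
qed

text \<open>Completing the square: the value of the complement at \<open>v\<close> is the value of
  the original form after shifting coordinate \<open>p\<close> by \<open>- y / a p p\<close>, the
  shift that minimizes it.\<close>

lemma pos_form_schur_complement:
  assumes "p < D" "a p p \<noteq> 0"
  shows "0 \<le> form D (\<lambda>i j. a i j - a i p * a p j / a p p) v"
proof -
  define y where "y = (\<Sum>j<D. a p j * v j)"
  have cy: "(\<Sum>i<D. cnj (v i) * a i p) = cnj y"
    unfolding y_def cnj_sum complex_cnj_mult
    by (intro sum.cong refl) (metis assms(1) lessThan_iff mult.commute pos_form_hermitian)
  have real: "cnj (a p p) = a p p"
    using pos_form_hermitian[OF assms(1) assms(1)] by simp
  have "form D (\<lambda>i j. a i j - a i p * a p j / a p p) v = form D a v -
      (\<Sum>i<D. \<Sum>j<D. (cnj (v i) * a i p) * (a p j * v j)) / a p p"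
    by (simp add: form_def sum_subtractf algebra_simps sum_divide_distrib)
  also have "\<dots> = form D a v - cnj y * y / a p p"
    by (simp add: sum_product[symmetric] cy y_def)
  also have "\<dots> = form D a (v(p := v p + (- y / a p p)))"
    unfolding form_update[OF assms(1)] cy y_def[symmetric] using assms real
    by (simp add: field_simps)
  finally show ?thesis using pos by simp
qed

end

text \<open>Induction as in the Cholesky decomposition, eliminating one row and column at a time.\<close>

lemma pos_form_decomposition:
  assumes "\<And>v. 0 \<le> form D a v" "r \<le> D"
    and "\<And>i j. i < D \<Longrightarrow> j < D \<Longrightarrow> i < D - r \<or> j < D - r \<Longrightarrow> a i j = 0"
  shows "\<exists>V. \<forall>i<D. \<forall>j<D. a i j = (\<Sum>l<r. V l i * cnj (V l j))"
  using assms
proof (induction r arbitrary: a)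
  case 0
  then show ?case by auto
next
  case (Suc r)
  \<comment> \<open>Only the last \<open>Suc r\<close> rows and columns can be nonzero. The pivot is
    the first of these, and eliminating it leaves the last \<open>r\<close>.\<close>
  define p where "p = D - Suc r"
  have p: "p < D" "D - r = Suc p" using Suc.prems(2) by (auto simp: p_def)
  show ?case
  proof (cases "a p p = 0")
    case True
    \<comment> \<open>A zero pivot has a zero row and column, so \<open>a\<close> itself already has
      the smaller support and the additional vector is zero.\<close>
    have "\<exists>V. \<forall>i<D. \<forall>j<D. a i j = (\<Sum>l<r. V l i * cnj (V l j))"
    proof (rule Suc.IH)
      fix i j assume "i < D" "j < D" "i < D - r \<or> j < D - r"
      then show "a i j = 0"
        using Suc.prems(3)[of i j] pos_form_zero_diag[OF Suc.prems(1) _ p(1) True] p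
        by (metis less_SucE p_def)
    qed (use Suc.prems in auto)
    then obtain V where V: "\<forall>i<D. \<forall>j<D. a i j = (\<Sum>l<r. V l i * cnj (V l j))" by blast
    show ?thesis
      by (rule exI[of _ "V(r := (\<lambda>_. 0))"]) (simp add: V)
  next
    case False
    let ?b = "\<lambda>i j. a i j - a i p * a p j / a p p"
    have "\<exists>V. \<forall>i<D. \<forall>j<D. ?b i j = (\<Sum>l<r. V l i * cnj (V l j))"
    proof (rule Suc.IH)
      show "0 \<le> form D ?b v" for v
        by (rule pos_form_schur_complement[OF Suc.prems(1) p(1) False])
    next
      fix i j assume ij: "i < D" "j < D" "i < D - r \<or> j < D - r"
      then consider "i < p \<or> j < p" | "i = p \<or> j = p" using p by (auto simp: less_Suc_eq)
      then show "?b i j = 0"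
      proof cases
        case 1
        then show ?thesis using Suc.prems(3)[of i j] Suc.prems(3)[of i p] Suc.prems(3)[of p j] ij p
          by (auto simp: p_def)
      next
        case 2
        then show ?thesis using False by auto
      qed
    qed (use Suc.prems in auto)
    then obtain V where V: "\<And>i j. i < D \<Longrightarrow> j < D \<Longrightarrow> ?b i j = (\<Sum>l<r. V l i * cnj (V l j))"
      by blast
    \<comment> \<open>The pivot is real and positive. Its column divided by the root
      \<open>s\<close> is the Cholesky column, whose outer product is the term subtracted in
      \<open>?b\<close>.\<close>
    define s where "s = sqrt (Re (a p p))"
    have app: "a p p = of_real (Re (a p p))" "0 < Re (a p p)"
      using pos_form_diag[OF Suc.prems(1) p(1)] False
      by (auto simp: complex_nonneg_iff complex_eq_iff)
    then have s: "complex_of_real s * complex_of_real s = a p p"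
      by (simp add: s_def flip: of_real_mult)
    show ?thesis
    proof (rule exI[of _ "V(r := (\<lambda>i. a i p / of_real s))"], intro allI impI)
      fix i j assume ij: "i < D" "j < D"
      have "a i p / of_real s * cnj (a j p / of_real s) = a i p * a p j / a p p"
        using pos_form_hermitian[OF Suc.prems(1) ij(2) p(1)] by (simp flip: s)
      then show "a i j = (\<Sum>l<Suc r. (V(r := (\<lambda>i. a i p / of_real s))) l i *
          cnj ((V(r := (\<lambda>i. a i p / of_real s))) l j))"
        using V[OF ij] by (simp add: algebra_simps)
    qed
  qed
qed

text \<open>For \<open>r = D\<close> the condition on vanishing entries is vacuous. This is the
  substitute for a spectral decomposition; the vectors \<open>V l\<close> need not be
  orthogonal.\<close>

lemma psd_decomposition:
  assumes "psd D A"
  obtains V where "\<And>i j. i < D \<Longrightarrow> j < D \<Longrightarrow> A $$ (i, j) = (\<Sum>l<D. V l i * cnj (V l j))"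
proof -
  have "\<exists>V. \<forall>i<D. \<forall>j<D. A $$ (i, j) = (\<Sum>l<D. V l i * cnj (V l j))"
    by (rule pos_form_decomposition) (use assms in \<open>auto simp: psd_iff\<close>)
  then show ?thesis using that by blast
qed

section \<open>Closure properties, trace inequalities and domination by the identity\<close>

lemma psd_add: "psd D A \<Longrightarrow> psd D B \<Longrightarrow> psd D (A + B)"
proof -
  assume A: "psd D A" and B: "psd D B"
  have "form D (\<lambda>i j. (A + B) $$ (i, j)) v =
      form D (\<lambda>i j. A $$ (i, j)) v + form D (\<lambda>i j. B $$ (i, j)) v" for v
    using psd_carrier[OF A] psd_carrier[OF B]
    by (simp add: form_def algebra_simps sum.distrib)
  then show ?thesis using A B by (auto simp: psd_iff)
qed

lemma psd_zero: "psd D (0\<^sub>m D D)"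
  by (simp add: psd_iff form_def)

lemma psd_one: "psd D (1\<^sub>m D)"
proof -
  have "form D (\<lambda>i j. 1\<^sub>m D $$ (i, j)) v = (\<Sum>i<D. cnj (v i) * v i)" for v
    unfolding form_def by (intro sum.cong refl) (simp add: if_distrib if_distribR cong: if_cong)
  then show ?thesis by (auto simp: psd_iff intro!: complex_sum_nonneg cnj_mult_self_nonneg)
qed

lemma psd_rank_one:
  assumes "A \<in> carrier_mat D D" "\<And>i j. i < D \<Longrightarrow> j < D \<Longrightarrow> A $$ (i, j) = u i * cnj (u j)"
  shows "psd D A"
proof -
  have "form D (\<lambda>i j. A $$ (i, j)) v = (\<Sum>i<D. cnj (v i) * u i) * cnj (\<Sum>i<D. cnj (v i) * u i)" for v
    by (simp add: form_def assms(2) sum_product mult_ac)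
  then show ?thesis
    unfolding psd_iff using assms(1) cnj_mult_self_nonneg(2) by metis
qed

lemma mat_trace_mult:
  assumes "A \<in> carrier_mat D D" "B \<in> carrier_mat D D"
  shows "mat_trace (A * B) = (\<Sum>i<D. \<Sum>j<D. A $$ (i, j) * B $$ (j, i))"
  using assms by (auto simp: mat_trace_def scalar_prod_def lessThan_atLeast0 row_def col_def
      intro!: sum.cong)

text \<open>Splitting \<open>A\<close> into rank-one terms turns the trace into a sum of values of
  the form of \<open>B\<close> at the vectors \<open>V l\<close>.\<close>

lemma mat_trace_mult_nonneg:
  assumes "psd D A" "psd D B"
  shows "0 \<le> mat_trace (A * B)"
proof -
  obtain V where V: "\<And>i j. i < D \<Longrightarrow> j < D \<Longrightarrow> A $$ (i, j) = (\<Sum>l<D. V l i * cnj (V l j))"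
    using psd_decomposition[OF assms(1)] by blast
  have "mat_trace (A * B) = (\<Sum>j<D. \<Sum>i<D. \<Sum>l<D. cnj (V l j) * B $$ (j, i) * V l i)"
    unfolding mat_trace_mult[OF assms[THEN psd_carrier]]
    by (subst sum.swap) (simp add: V sum_distrib_left sum_distrib_right mult_ac)
  also have "\<dots> = (\<Sum>j<D. \<Sum>l<D. \<Sum>i<D. cnj (V l j) * B $$ (j, i) * V l i)"
    by (intro sum.cong refl sum.swap)
  also have "\<dots> = (\<Sum>l<D. form D (\<lambda>i j. B $$ (i, j)) (V l))"
    unfolding form_def by (rule sum.swap)
  also have "0 \<le> \<dots>"
    using assms(2) by (intro complex_sum_nonneg) (simp add: psd_iff)
  finally show ?thesis .
qed

text \<open>The form of \<open>A\<close> at \<open>v\<close> is the sum of the squared moduli of the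
  inner products of \<open>v\<close> with the \<open>V l\<close>. By Cauchy-Schwarz this is at most
  the squared norm of \<open>v\<close> times the sum of the squared norms of the \<open>V l\<close>,
  and the latter sum is the trace.\<close>

lemma psd_trace_bound:
  assumes "psd D A" "mat_trace A = 1"
  shows "psd D (1\<^sub>m D - A)"
proof -
  obtain V where V: "\<And>i j. i < D \<Longrightarrow> j < D \<Longrightarrow> A $$ (i, j) = (\<Sum>l<D. V l i * cnj (V l j))"
    using psd_decomposition[OF assms(1)] by blast
  have car: "A \<in> carrier_mat D D" using assms by (simp add: psd_carrier)
  have tr: "(\<Sum>l<D. \<Sum>i<D. (cmod (V l i))\<^sup>2) = 1"
  proof -
    have "complex_of_real (\<Sum>l<D. \<Sum>i<D. (cmod (V l i))\<^sup>2) = (\<Sum>i<D. A $$ (i, i))"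
      by (subst sum.swap) (simp add: V complex_norm_square del: of_real_power)
    also have "\<dots> = 1" using assms(2) car by (simp add: mat_trace_def)
    finally show ?thesis by (simp only: of_real_eq_1_iff)
  qed
  have CS: "(cmod (\<Sum>i<D. cnj (v i) * u i))\<^sup>2 \<le> (\<Sum>i<D. (cmod (v i))\<^sup>2) * (\<Sum>i<D. (cmod (u i))\<^sup>2)"
    for u v
  proof -
    have "cmod (\<Sum>i<D. cnj (v i) * u i) \<le> (\<Sum>i<D. \<bar>cmod (v i)\<bar> * \<bar>cmod (u i)\<bar>)"
      by (rule order_trans[OF norm_sum]) (simp add: norm_mult)
    also have "\<dots> \<le> L2_set (\<lambda>i. cmod (v i)) {..<D} * L2_set (\<lambda>i. cmod (u i)) {..<D}"
      by (rule L2_set_mult_ineq)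
    finally have "(cmod (\<Sum>i<D. cnj (v i) * u i))\<^sup>2 \<le>
        (L2_set (\<lambda>i. cmod (v i)) {..<D} * L2_set (\<lambda>i. cmod (u i)) {..<D})\<^sup>2"
      by (intro power_mono) auto
    then show ?thesis by (simp add: power_mult_distrib L2_set_def sum_nonneg)
  qed
  have "0 \<le> form D (\<lambda>i j. (1\<^sub>m D - A) $$ (i, j)) v" for v
  proof -
    have id: "form D (\<lambda>i j. 1\<^sub>m D $$ (i, j)) v = of_real (\<Sum>i<D. (cmod (v i))\<^sup>2)"
      unfolding form_def of_real_sum
      by (intro sum.cong refl)
        (simp add: if_distrib if_distribR complex_norm_square mult.commute del: of_real_power cong: if_cong)
    have "form D (\<lambda>i j. A $$ (i, j)) v = (\<Sum>i<D. \<Sum>j<D. \<Sum>l<D. (cnj (v i) * V l i) * (v j * cnj (V l j)))"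
      by (simp add: form_def V sum_distrib_left sum_distrib_right mult_ac)
    also have "\<dots> = (\<Sum>i<D. \<Sum>l<D. \<Sum>j<D. (cnj (v i) * V l i) * (v j * cnj (V l j)))"
      by (intro sum.cong refl sum.swap)
    also have "\<dots> = (\<Sum>l<D. \<Sum>i<D. \<Sum>j<D. (cnj (v i) * V l i) * (v j * cnj (V l j)))"
      by (rule sum.swap)
    also have "\<dots> = (\<Sum>l<D. (\<Sum>i<D. cnj (v i) * V l i) * cnj (\<Sum>i<D. cnj (v i) * V l i))"
      by (simp add: sum_product)
    also have "\<dots> = of_real (\<Sum>l<D. (cmod (\<Sum>i<D. cnj (v i) * V l i))\<^sup>2)"
      by (simp add: complex_norm_square del: of_real_power complex_cnj_mult)
    finally have A: "form D (\<lambda>i j. A $$ (i, j)) v = of_real (\<Sum>l<D. (cmod (\<Sum>i<D. cnj (v i) * V l i))\<^sup>2)" .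
    have "(\<Sum>l<D. (cmod (\<Sum>i<D. cnj (v i) * V l i))\<^sup>2) \<le>
        (\<Sum>l<D. (\<Sum>i<D. (cmod (v i))\<^sup>2) * (\<Sum>i<D. (cmod (V l i))\<^sup>2))"
      by (intro sum_mono CS)
    also have "\<dots> = (\<Sum>i<D. (cmod (v i))\<^sup>2)"
      by (simp add: sum_distrib_left[symmetric] tr)
    finally have le: "(\<Sum>l<D. (cmod (\<Sum>i<D. cnj (v i) * V l i))\<^sup>2) \<le> (\<Sum>i<D. (cmod (v i))\<^sup>2)" .
    have "form D (\<lambda>i j. (1\<^sub>m D - A) $$ (i, j)) v =
        form D (\<lambda>i j. 1\<^sub>m D $$ (i, j)) v - form D (\<lambda>i j. A $$ (i, j)) v"
      using car by (simp add: form_def algebra_simps sum_subtractf)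
    also have "\<dots> = of_real ((\<Sum>i<D. (cmod (v i))\<^sup>2) - (\<Sum>l<D. (cmod (\<Sum>i<D. cnj (v i) * V l i))\<^sup>2))"
      unfolding id A by simp
    also have "0 \<le> \<dots>"
      using le by (simp only: complex_nonneg_iff Re_complex_of_real Im_complex_of_real) simp
    finally show ?thesis .
  qed
  then show ?thesis using car by (simp add: psd_iff minus_carrier_mat)
qed

section \<open>Outcome probabilities of measurements\<close>

lemma povm_sum:
  assumes "povm D A M" "i < D" "j < D"
  shows "(\<Sum>a\<in>A. M a $$ (i, j)) = (if i = j then 1 else 0)"
proof -
  have "mat D D (\<lambda>ij. \<Sum>a\<in>A. M a $$ ij) $$ (i, j) = 1\<^sub>m D $$ (i, j)"
    using assms by (simp add: povm_def)
  then show ?thesis using assms by simp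
qed

text \<open>A general sum \<open>N\<close> is allowed because marginals of a product measurement add
  up to \<open>kron C 1\<close> or \<open>kron 1 C\<close> rather than to the identity.\<close>

lemma mat_trace_mult_sum:
  assumes "\<And>a. a \<in> A \<Longrightarrow> M a \<in> carrier_mat D D" "N \<in> carrier_mat D D" "T \<in> carrier_mat D D"
    and "\<And>i j. i < D \<Longrightarrow> j < D \<Longrightarrow> (\<Sum>a\<in>A. M a $$ (i, j)) = N $$ (i, j)"
  shows "(\<Sum>a\<in>A. mat_trace (M a * T)) = mat_trace (N * T)"
proof -
  have "(\<Sum>a\<in>A. mat_trace (M a * T)) = (\<Sum>a\<in>A. \<Sum>i<D. \<Sum>j<D. M a $$ (i, j) * T $$ (j, i))"
    using assms by (intro sum.cong refl mat_trace_mult)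
  also have "\<dots> = (\<Sum>i<D. \<Sum>a\<in>A. \<Sum>j<D. M a $$ (i, j) * T $$ (j, i))"
    by (rule sum.swap)
  also have "\<dots> = (\<Sum>i<D. \<Sum>j<D. \<Sum>a\<in>A. M a $$ (i, j) * T $$ (j, i))"
    by (intro sum.cong refl sum.swap)
  also have "\<dots> = (\<Sum>i<D. \<Sum>j<D. N $$ (i, j) * T $$ (j, i))"
    by (intro sum.cong refl) (simp add: sum_distrib_right[symmetric] assms(4))
  also have "\<dots> = mat_trace (N * T)"
    using assms by (intro mat_trace_mult[symmetric])
  finally show ?thesis .
qed

lemma povm_trace_sum:
  assumes "povm D A M" "T \<in> carrier_mat D D"
  shows "(\<Sum>a\<in>A. mat_trace (M a * T)) = mat_trace T"
proof -
  have "(\<Sum>a\<in>A. mat_trace (M a * T)) = mat_trace (1\<^sub>m D * T)"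
    using assms by (intro mat_trace_mult_sum) (auto simp: povm_sum povm_def psd_carrier)
  then show ?thesis using assms(2) by simp
qed

text \<open>The bounds are in the order on complex numbers, hence they also say that the trace is
  real, which is what membership in the quantum sets requires.\<close>

lemma povm_prob_le_one:
  assumes "povm D A M" "finite A" "a \<in> A" "density D T"
  shows "0 \<le> mat_trace (M a * T)" "mat_trace (M a * T) \<le> 1"
proof -
  have nonneg: "0 \<le> mat_trace (M b * T)" if "b \<in> A" for b
    using assms that by (auto simp: povm_def density_def intro: mat_trace_mult_nonneg)
  then show "0 \<le> mat_trace (M a * T)" using assms by simp
  have "(\<Sum>b\<in>A. mat_trace (M b * T)) = mat_trace T"
    using assms by (intro povm_trace_sum) (auto simp: density_def psd_carrier)
  then have "mat_trace (M a * T) + (\<Sum>b\<in>A - {a}. mat_trace (M b * T)) = 1"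
    using assms by (simp add: density_def sum.remove[of A a])
  moreover have "0 \<le> (\<Sum>b\<in>A - {a}. mat_trace (M b * T))"
    by (rule complex_sum_nonneg) (simp add: nonneg)
  ultimately show "mat_trace (M a * T) \<le> 1"
    by (metis add_left_mono add.right_neutral)
qed

section \<open>Kronecker products\<close>

lemma index_less:
  assumes "i < a" "j < (b::nat)"
  shows "i * b + j < a * b"
proof -
  have "Suc i * b \<le> a * b" using assms by (intro mult_right_mono) auto
  then show ?thesis using assms by simp
qed

lemma index_cases:
  assumes "x < a * (b::nat)"
  obtains i j where "x = i * b + j" "i < a" "j < b"
proof
  show "x = (x div b) * b + x mod b" by simp
  show "x div b < a" using assms by (simp add: less_mult_imp_div_less)
  show "x mod b < b" using assms by (metis mod_less_divisor mult_0_right neq0_conv not_less0)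
qed

lemma index_div_mod [simp]:
  assumes "j < (b::nat)"
  shows "(i * b + j) div b = i" "(i * b + j) mod b = j"
  using assms by simp_all

lemma sum_index:
  fixes g :: "nat \<Rightarrow> 'a::comm_monoid_add"
  shows "(\<Sum>x<a * b. g x) = (\<Sum>i<a. \<Sum>j<b. g (i * b + j))"
proof -
  have "(\<Sum>j = i * b..<i * b + b. g j) = (\<Sum>j<b. g (i * b + j))" for i
    using sum.shift_bounds_nat_ivl[of g 0 "i * b" b] by (simp add: lessThan_atLeast0 add.commute)
  then show ?thesis
    by (simp add: sum.nat_group[symmetric])
qed

lemma kron_carrier:
  "A \<in> carrier_mat a a' \<Longrightarrow> B \<in> carrier_mat b b' \<Longrightarrow> kron A B \<in> carrier_mat (a * b) (a' * b')"
  by (auto simp: kron_def)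

lemma kron_index:
  assumes "A \<in> carrier_mat a a" "B \<in> carrier_mat b b" "i < a" "j < b" "i' < a" "j' < b"
  shows "kron A B $$ (i * b + j, i' * b + j') = A $$ (i, i') * B $$ (j, j')"
  using assms index_less[of i a j b] index_less[of i' a j' b] by (simp add: kron_def)

lemma eq_mat_index:
  assumes "A \<in> carrier_mat (a * b) (a * b)" "B \<in> carrier_mat (a * b) (a * b)"
    and "\<And>i j i' j'. i < a \<Longrightarrow> j < b \<Longrightarrow> i' < a \<Longrightarrow> j' < b \<Longrightarrow>
      A $$ (i * b + j, i' * b + j') = B $$ (i * b + j, i' * b + j')"
  shows "A = B"
proof (rule eq_matI)
  fix x y assume "x < dim_row B" "y < dim_col B"
  then have "x < a * b" "y < a * b" using assms(2) by auto
  then show "A $$ (x, y) = B $$ (x, y)"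
    using assms(3) by (elim index_cases) auto
qed (use assms in auto)

text \<open>Vectors of a tensor product become arrays \<open>v i j\<close>, so the two factors can
  be summed separately, without \<open>div\<close> and \<open>mod\<close>.\<close>

lemma psd_index_iff:
  "psd (a * b) A \<longleftrightarrow> A \<in> carrier_mat (a * b) (a * b) \<and>
    (\<forall>v. 0 \<le> (\<Sum>i<a. \<Sum>j<b. \<Sum>i'<a. \<Sum>j'<b. cnj (v i j) * A $$ (i * b + j, i' * b + j') * v i' j'))"
  (is "_ \<longleftrightarrow> _ \<and> (\<forall>v. 0 \<le> ?q v)")
proof -
  have 1: "form (a * b) (\<lambda>i j. A $$ (i, j)) v = ?q (\<lambda>i j. v (i * b + j))" for v
    by (simp add: form_def sum_index)
  have 2: "?q v = form (a * b) (\<lambda>i j. A $$ (i, j)) (\<lambda>x. v (x div b) (x mod b))" for v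
    unfolding 1 by (intro sum.cong refl) simp
  have "(\<forall>v. 0 \<le> form (a * b) (\<lambda>i j. A $$ (i, j)) v) \<longleftrightarrow> (\<forall>v. 0 \<le> ?q v)"
  proof (intro iffI allI)
    fix v assume "\<forall>v. 0 \<le> form (a * b) (\<lambda>i j. A $$ (i, j)) v"
    then show "0 \<le> ?q v" unfolding 2 by (rule spec)
  next
    fix v assume "\<forall>v. 0 \<le> ?q v"
    then show "0 \<le> form (a * b) (\<lambda>i j. A $$ (i, j)) v" unfolding 1 by (rule spec)
  qed
  then show ?thesis unfolding psd_iff by (rule arg_cong)
qed

text \<open>Decomposing only \<open>A\<close> suffices: contracting \<open>v\<close> with
  \<open>V l\<close> in the first factor gives \<open>?u l\<close>, and the form of the product is
  the sum of the forms of \<open>B\<close> at these vectors.\<close>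

lemma psd_kron:
  assumes "psd a A" "psd b B"
  shows "psd (a * b) (kron A B)"
proof -
  note car = assms[THEN psd_carrier]
  obtain V where V: "\<And>i j. i < a \<Longrightarrow> j < a \<Longrightarrow> A $$ (i, j) = (\<Sum>l<a. V l i * cnj (V l j))"
    using psd_decomposition[OF assms(1)] by blast
  have "0 \<le> (\<Sum>i<a. \<Sum>j<b. \<Sum>i'<a. \<Sum>j'<b.
      cnj (v i j) * kron A B $$ (i * b + j, i' * b + j') * v i' j')" for v
  proof -
    let ?u = "\<lambda>l j. \<Sum>i<a. cnj (V l i) * v i j"
    let ?f = "\<lambda>l i j i' j'. (V l i * cnj (v i j)) * B $$ (j, j') * (cnj (V l i') * v i' j')"
    have "(\<Sum>i<a. \<Sum>j<b. \<Sum>i'<a. \<Sum>j'<b. cnj (v i j) * kron A B $$ (i * b + j, i' * b + j') * v i' j')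
        = (\<Sum>i<a. \<Sum>j<b. \<Sum>i'<a. \<Sum>j'<b. \<Sum>l<a. ?f l i j i' j')"
      by (intro sum.cong refl) (simp add: kron_index[OF car] V sum_distrib_left sum_distrib_right mult_ac)
    also have "\<dots> = (\<Sum>i<a. \<Sum>j<b. \<Sum>i'<a. \<Sum>l<a. \<Sum>j'<b. ?f l i j i' j')"
      by (intro sum.cong refl sum.swap)
    also have "\<dots> = (\<Sum>i<a. \<Sum>j<b. \<Sum>l<a. \<Sum>i'<a. \<Sum>j'<b. ?f l i j i' j')"
      by (intro sum.cong refl sum.swap)
    also have "\<dots> = (\<Sum>i<a. \<Sum>l<a. \<Sum>j<b. \<Sum>i'<a. \<Sum>j'<b. ?f l i j i' j')"
      by (intro sum.cong refl sum.swap)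
    also have "\<dots> = (\<Sum>l<a. \<Sum>i<a. \<Sum>j<b. \<Sum>i'<a. \<Sum>j'<b. ?f l i j i' j')"
      by (rule sum.swap)
    also have "\<dots> = (\<Sum>l<a. form b (\<lambda>i j. B $$ (i, j)) (?u l))"
    proof (intro sum.cong refl)
      fix l
      have "(\<Sum>i<a. \<Sum>j<b. \<Sum>i'<a. \<Sum>j'<b. ?f l i j i' j')
          = (\<Sum>j<b. \<Sum>i<a. \<Sum>i'<a. \<Sum>j'<b. ?f l i j i' j')"
        by (rule sum.swap)
      also have "\<dots> = (\<Sum>j<b. \<Sum>i<a. \<Sum>j'<b. \<Sum>i'<a. ?f l i j i' j')"
        by (intro sum.cong refl sum.swap)
      also have "\<dots> = (\<Sum>j<b. \<Sum>j'<b. \<Sum>i<a. \<Sum>i'<a. ?f l i j i' j')"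
        by (intro sum.cong refl sum.swap)
      also have "\<dots> = form b (\<lambda>i j. B $$ (i, j)) (?u l)"
        unfolding form_def
        by (intro sum.cong refl) (simp add: sum_distrib_left sum_distrib_right mult_ac)
      finally show "(\<Sum>i<a. \<Sum>j<b. \<Sum>i'<a. \<Sum>j'<b. ?f l i j i' j') = form b (\<lambda>i j. B $$ (i, j)) (?u l)" .
    qed
    also have "0 \<le> \<dots>"
      using assms(2) by (intro complex_sum_nonneg) (simp add: psd_iff)
    finally show ?thesis .
  qed
  then show ?thesis using kron_carrier[OF car] by (simp add: psd_index_iff)
qed

lemma mat_trace_kron:
  assumes "A \<in> carrier_mat a a" "B \<in> carrier_mat b b"
  shows "mat_trace (kron A B) = mat_trace A * mat_trace B"
  using assms kron_carrier[OF assms]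
  by (simp add: mat_trace_def sum_index kron_index[OF assms] sum_product)

lemma kron_mult:
  assumes "A \<in> carrier_mat a a" "B \<in> carrier_mat b b" "A' \<in> carrier_mat a a" "B' \<in> carrier_mat b b"
  shows "kron A B * kron A' B' = kron (A * A') (B * B')"
proof (rule eq_mat_index)
  have entry: "(X * Y) $$ (i, j) = (\<Sum>k<n. X $$ (i, k) * Y $$ (k, j))"
    if "X \<in> carrier_mat n n" "Y \<in> carrier_mat n n" "i < n" "j < n" for X Y :: "complex mat" and i j n
    using that by (auto simp: scalar_prod_def lessThan_atLeast0 row_def col_def intro!: sum.cong)
  fix i j i' j' assume ij: "i < a" "j < b" "i' < a" "j' < b"
  note kc = kron_carrier[OF assms(1,2)] kron_carrier[OF assms(3,4)]
  have "(kron A B * kron A' B') $$ (i * b + j, i' * b + j')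
      = (\<Sum>k<a. \<Sum>l<b. (A $$ (i, k) * A' $$ (k, i')) * (B $$ (j, l) * B' $$ (l, j')))"
    unfolding entry[OF kc index_less[OF ij(1,2)] index_less[OF ij(3,4)]] sum_index
    using ij by (intro sum.cong refl) (simp add: kron_index[OF assms(1,2)] kron_index[OF assms(3,4)])
  also have "\<dots> = (A * A') $$ (i, i') * (B * B') $$ (j, j')"
    using ij by (simp only: entry[OF assms(1,3)] entry[OF assms(2,4)] sum_product)
  also have "\<dots> = kron (A * A') (B * B') $$ (i * b + j, i' * b + j')"
    using ij assms by (intro kron_index[symmetric]) auto
  finally show "(kron A B * kron A' B') $$ (i * b + j, i' * b + j') =
    kron (A * A') (B * B') $$ (i * b + j, i' * b + j')" .
qed (use assms in \<open>auto intro!: mult_carrier_mat[of _ "a * b" "a * b"] kron_carrier\<close>)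

lemma kron_one: "kron (1\<^sub>m a) (1\<^sub>m b) = 1\<^sub>m (a * b)"
proof (rule eq_mat_index)
  fix i j i' j' assume ij: "i < a" "j < b" "i' < a" "j' < b"
  have "i * b + j = i' * b + j' \<longleftrightarrow> i = i' \<and> j = j'"
    using index_div_mod[OF ij(2)] index_div_mod[OF ij(4)] by metis
  then show "kron (1\<^sub>m a) (1\<^sub>m b) $$ (i * b + j, i' * b + j') = 1\<^sub>m (a * b) $$ (i * b + j, i' * b + j')"
    using ij index_less[OF ij(1,2)] index_less[OF ij(3,4)]
    by (simp add: kron_index[OF one_carrier_mat one_carrier_mat])
qed (use kron_carrier[OF one_carrier_mat one_carrier_mat] in auto)

text \<open>Monotonicity in the Loewner order: \<open>A' \<otimes> B' - A \<otimes> B = (A' - A) \<otimes> B' + A \<otimes> (B' - B)\<close>.\<close>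

lemma kron_mono:
  assumes "psd a A" "psd a (A' - A)" "A' \<in> carrier_mat a a"
    and "psd b B" "psd b (B' - B)" "B' \<in> carrier_mat b b"
    and "psd b B'"
  shows "psd (a * b) (kron A' B' - kron A B)"
proof -
  note car = psd_carrier[OF assms(1)] psd_carrier[OF assms(4)]
  have car': "A' - A \<in> carrier_mat a a" "B' - B \<in> carrier_mat b b"
    using assms by (auto dest: psd_carrier)
  have "kron A' B' - kron A B = kron (A' - A) B' + kron A (B' - B)"
  proof (rule eq_mat_index)
    fix i j i' j' assume ij: "i < a" "j < b" "i' < a" "j' < b"
    have l: "i * b + j < a * b" "i' * b + j' < a * b" using ij by (auto intro: index_less)
    show "(kron A' B' - kron A B) $$ (i * b + j, i' * b + j') =
        (kron (A' - A) B' + kron A (B' - B)) $$ (i * b + j, i' * b + j')"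
      using ij l car car' assms kron_carrier[OF car] kron_carrier[OF car'(1) assms(6)]
        kron_carrier[OF car(1) car'(2)] kron_carrier[OF assms(3,6)]
      by (simp add: kron_index[OF car] kron_index[OF assms(3,6)] kron_index[OF car'(1) assms(6)]
          kron_index[OF car(1) car'(2)] left_diff_distrib right_diff_distrib)
  qed (use car car' assms kron_carrier[of _ a a _ b b] in \<open>auto intro!: minus_carrier_mat\<close>)
  then show ?thesis
    using assms by (simp add: psd_add psd_kron)
qed

section \<open>Tensor products\<close>

lemma tensor_carrier:
  assumes "\<And>j. j < K \<Longrightarrow> A j \<in> carrier_mat (d j) (d j)"
  shows "tensor K A \<in> carrier_mat (\<Prod>j<K. d j) (\<Prod>j<K. d j)"
  using assms by (induction K) (auto intro!: kron_carrier)

lemma tensor_cong: "(\<And>j. j < K \<Longrightarrow> A j = B j) \<Longrightarrow> tensor K A = tensor K B"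
  by (induction K) auto

lemma tensor_psd:
  assumes "\<And>j. j < K \<Longrightarrow> psd (d j) (A j)"
  shows "psd (\<Prod>j<K. d j) (tensor K A)"
  using assms by (induction K) (auto intro!: psd_kron psd_one)

lemma mat_trace_tensor:
  assumes "\<And>j. j < K \<Longrightarrow> A j \<in> carrier_mat (d j) (d j)"
  shows "mat_trace (tensor K A) = (\<Prod>j<K. mat_trace (A j))"
  using assms
proof (induction K)
  case 0
  then show ?case by (simp add: mat_trace_def)
next
  case (Suc K)
  then show ?case
    using mat_trace_kron[OF tensor_carrier[of K A d] Suc.prems[of K]] by simp
qed

lemma tensor_density:
  assumes "\<And>j. j < K \<Longrightarrow> density (d j) (A j)"
  shows "density (\<Prod>j<K. d j) (tensor K A)"
proof -
  have "mat_trace (tensor K A) = (\<Prod>j<K. mat_trace (A j))"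
    using assms by (intro mat_trace_tensor[of K A d]) (auto simp: density_def psd_carrier)
  then show ?thesis
    using assms by (auto simp: density_def intro: tensor_psd)
qed

lemma tensor_mult:
  assumes "\<And>j. j < K \<Longrightarrow> A j \<in> carrier_mat (d j) (d j)" "\<And>j. j < K \<Longrightarrow> B j \<in> carrier_mat (d j) (d j)"
  shows "tensor K A * tensor K B = tensor K (\<lambda>j. A j * B j)"
  using assms
proof (induction K)
  case (Suc K)
  then show ?case
    using kron_mult[OF tensor_carrier[of K A d] _ tensor_carrier[of K B d], of "A K" "d K" "B K"] by simp
qed auto

lemma tensor_one: "tensor K (\<lambda>j. 1\<^sub>m (d j)) = 1\<^sub>m (\<Prod>j<K. d j)"
  by (induction K) (auto simp: kron_one)

lemma tensor_mono:
  assumes "\<And>j. j < K \<Longrightarrow> psd (d j) (A j)" "\<And>j. j < K \<Longrightarrow> psd (d j) (B j)"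
    and "\<And>j. j < K \<Longrightarrow> psd (d j) (B j - A j)"
  shows "psd (\<Prod>j<K. d j) (tensor K B - tensor K A)"
  using assms
proof (induction K)
  case 0
  have "1\<^sub>m 1 - 1\<^sub>m 1 = (0\<^sub>m 1 1 :: complex mat)" by auto
  then show ?case by (simp only: tensor.simps lessThan_0 prod.empty psd_zero)
next
  case (Suc K)
  then show ?case
    using kron_mono[OF tensor_psd[of K d A] Suc.IH _ Suc.prems(1)[of K] Suc.prems(3)[of K]]
      tensor_psd[of K d B] by (simp add: psd_carrier)
qed

text \<open>The positions \<open>a\<close> and \<open>b\<close> are the digit expansions of the row and column index.\<close>

lemma tensor_index:
  fixes d :: "nat \<Rightarrow> nat"
  assumes "x < (\<Prod>j<K. d j)" "y < (\<Prod>j<K. d j)"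
  obtains a b where "\<And>j. j < K \<Longrightarrow> a j < d j" "\<And>j. j < K \<Longrightarrow> b j < d j"
    "\<And>A. (\<And>j. j < K \<Longrightarrow> A j \<in> carrier_mat (d j) (d j)) \<Longrightarrow>
      tensor K A $$ (x, y) = (\<Prod>j<K. A j $$ (a j, b j))"
proof -
  have "\<exists>a b. (\<forall>j<K. a j < d j) \<and> (\<forall>j<K. b j < d j) \<and>
    (\<forall>A. (\<forall>j<K. A j \<in> carrier_mat (d j) (d j)) \<longrightarrow> tensor K A $$ (x, y) = (\<Prod>j<K. A j $$ (a j, b j)))"
    using assms
  proof (induction K arbitrary: x y)
    case (Suc K)
    from Suc.prems obtain x1 x2 where x: "x = x1 * d K + x2" "x1 < (\<Prod>j<K. d j)" "x2 < d K"
      by (auto elim: index_cases)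
    from Suc.prems obtain y1 y2 where y: "y = y1 * d K + y2" "y1 < (\<Prod>j<K. d j)" "y2 < d K"
      by (auto elim: index_cases)
    obtain a b where ab: "\<forall>j<K. a j < d j" "\<forall>j<K. b j < d j"
      "\<forall>A. (\<forall>j<K. A j \<in> carrier_mat (d j) (d j)) \<longrightarrow> tensor K A $$ (x1, y1) = (\<Prod>j<K. A j $$ (a j, b j))"
      using Suc.IH[OF x(2) y(2)] by blast
    have "tensor (Suc K) A $$ (x, y) = (\<Prod>j<Suc K. A j $$ ((a(K := x2)) j, (b(K := y2)) j))"
      if A: "\<forall>j<Suc K. A j \<in> carrier_mat (d j) (d j)" for A
    proof -
      have "tensor (Suc K) A $$ (x, y) = tensor K A $$ (x1, y1) * A K $$ (x2, y2)"
        using A x y kron_index[OF tensor_carrier[of K A d], of "A K" "d K" x1 x2 y1 y2] by simp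
      then show ?thesis using ab(3) A by simp
    qed
    then show ?case
      using ab x(3) y(3)
      by (intro exI[of _ "a(K := x2)"] exI[of _ "b(K := y2)"]) (auto simp: less_Suc_eq)
  qed auto
  then show ?thesis using that by blast
qed

text \<open>Every entry of a tensor product is a product of entries at positions independent of the
  factors, so the sum over outcome tuples factors by distributivity into the completeness relations
  of the factors.\<close>

lemma tensor_povm:
  assumes "\<And>j. j < K \<Longrightarrow> povm (d j) (Z j) (M j)" "\<And>j. j < K \<Longrightarrow> finite (Z j)"
  shows "povm (\<Prod>j<K. d j) (PiE {..<K} Z) (\<lambda>z. tensor K (\<lambda>j. M j (z j)))"
proof -
  have psd: "psd (d j) (M j (z j))" if "z \<in> PiE {..<K} Z" "j < K" for z j
    using assms(1)[OF that(2)] that by (auto simp: povm_def PiE_def)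
  have "(\<Sum>z\<in>PiE {..<K} Z. tensor K (\<lambda>j. M j (z j)) $$ (x, y)) = 1\<^sub>m (\<Prod>j<K. d j) $$ (x, y)"
    if xy: "x < (\<Prod>j<K. d j)" "y < (\<Prod>j<K. d j)" for x y
  proof -
    obtain a b where ab: "\<And>j. j < K \<Longrightarrow> a j < d j" "\<And>j. j < K \<Longrightarrow> b j < d j"
      "\<And>A. (\<And>j. j < K \<Longrightarrow> A j \<in> carrier_mat (d j) (d j)) \<Longrightarrow>
        tensor K A $$ (x, y) = (\<Prod>j<K. A j $$ (a j, b j))"
      using tensor_index[OF xy] by blast
    have "(\<Sum>z\<in>PiE {..<K} Z. tensor K (\<lambda>j. M j (z j)) $$ (x, y))
        = (\<Sum>z\<in>PiE {..<K} Z. \<Prod>j<K. M j (z j) $$ (a j, b j))"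
      by (intro sum.cong refl ab(3)) (auto intro: psd psd_carrier)
    also have "\<dots> = (\<Prod>j<K. \<Sum>z\<in>Z j. M j z $$ (a j, b j))"
      using assms(2) by (intro prod_sum_PiE[symmetric]) auto
    also have "\<dots> = (\<Prod>j<K. 1\<^sub>m (d j) $$ (a j, b j))"
      using ab(1,2) by (intro prod.cong refl) (simp add: povm_sum[OF assms(1)])
    also have "\<dots> = tensor K (\<lambda>j. 1\<^sub>m (d j)) $$ (x, y)"
      by (rule ab(3)[symmetric]) simp
    finally show ?thesis by (simp add: tensor_one)
  qed
  then show ?thesis
    unfolding povm_def by (auto intro!: tensor_psd psd eq_matI)
qed

section \<open>Quantum channels\<close>

lemma matrix_unit_carrier [simp]: "matrix_unit D a b \<in> carrier_mat D D"
  by (simp add: matrix_unit_def)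

lemma matrix_unit_index [simp]:
  "i < D \<Longrightarrow> j < D \<Longrightarrow> matrix_unit D a b $$ (i, j) = (if i = a \<and> j = b then 1 else 0)"
  by (simp add: matrix_unit_def)

lemma mat_trace_matrix_unit: "a < D \<Longrightarrow> mat_trace (matrix_unit D a b) = (if a = b then 1 else 0)"
proof -
  assume "a < D"
  have "mat_trace (matrix_unit D a b) = (\<Sum>i<D. if i = a \<and> i = b then 1 else 0)"
    by (simp add: mat_trace_def matrix_unit_def)
  also have "\<dots> = (\<Sum>i<D. if i = a then (if a = b then 1 else 0) else 0)"
    by (rule sum.cong) auto
  finally show ?thesis using \<open>a < D\<close> by simp
qed

lemma map_tensor_carrier: "map_tensor D D' d d' E F X \<in> carrier_mat (d * d') (d * d')"
  by (simp add: map_tensor_def)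

lemma map_tensor_index:
  assumes "\<And>a a'. E (matrix_unit D a a') \<in> carrier_mat d d"
    and "\<And>b b'. F (matrix_unit D' b b') \<in> carrier_mat d' d'"
    and "i < d" "j < d'" "i' < d" "j' < d'"
  shows "map_tensor D D' d d' E F X $$ (i * d' + j, i' * d' + j') =
    (\<Sum>a<D. \<Sum>a'<D. \<Sum>b<D'. \<Sum>b'<D'. X $$ (a * D' + b, a' * D' + b') *
      (E (matrix_unit D a a') $$ (i, i') * F (matrix_unit D' b b') $$ (j, j')))"
  using index_less[OF assms(3,4)] index_less[OF assms(5,6)]
  by (simp add: map_tensor_def kron_index[OF assms(1,2,3,4,5,6)])

lemma sum_pair_delta:
  fixes g :: "nat \<Rightarrow> nat \<Rightarrow> complex"
  assumes "x < D" "y < D"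
  shows "(\<Sum>a<D. \<Sum>a'<D. g a a' * (if x = a \<and> y = a' then c else 0)) = g x y * c"
proof -
  have "(\<Sum>a<D. \<Sum>a'<D. g a a' * (if x = a \<and> y = a' then c else 0)) =
      (\<Sum>a<D. if x = a then g x y * c else 0)"
  proof (intro sum.cong refl)
    fix a
    have "(\<Sum>a'<D. g a a' * (if x = a \<and> y = a' then c else 0)) =
        (\<Sum>a'<D. if y = a' then (if x = a then g a y * c else 0) else 0)"
      by (intro sum.cong refl) auto
    then show "(\<Sum>a'<D. g a a' * (if x = a \<and> y = a' then c else 0)) = (if x = a then g x y * c else 0)"
      using assms by auto
  qed
  then show ?thesis using assms by simp
qed

lemma map_tensor_id_index:
  assumes "\<And>a a'. E (matrix_unit D a a') \<in> carrier_mat d d"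
    and "i < d" "j < m" "i' < d" "j' < m"
  shows "map_tensor D m d m E (\<lambda>Y. Y) X $$ (i * m + j, i' * m + j') =
    (\<Sum>a<D. \<Sum>a'<D. X $$ (a * m + j, a' * m + j') * E (matrix_unit D a a') $$ (i, i'))"
proof -
  have "map_tensor D m d m E (\<lambda>Y. Y) X $$ (i * m + j, i' * m + j') =
      (\<Sum>a<D. \<Sum>a'<D. \<Sum>b<m. \<Sum>b'<m. X $$ (a * m + b, a' * m + b') *
        (if j = b \<and> j' = b' then E (matrix_unit D a a') $$ (i, i') else 0))"
    unfolding map_tensor_index[of E D d "\<lambda>Y. Y" m m, OF assms(1) matrix_unit_carrier assms(2-5)]
    using assms(3,5) by (intro sum.cong refl) auto
  then show ?thesis using assms(3,5) by (simp add: sum_pair_delta)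
qed

definition swap_factors :: "nat \<Rightarrow> nat \<Rightarrow> complex mat \<Rightarrow> complex mat" where
  "swap_factors a b X = mat (b * a) (b * a)
     (\<lambda>(x, y). X $$ ((x mod a) * b + x div a, (y mod a) * b + y div a))"

lemma swap_factors_index:
  assumes "i < a" "j < b" "i' < a" "j' < b"
  shows "swap_factors a b X $$ (j * a + i, j' * a + i') = X $$ (i * b + j, i' * b + j')"
  using assms index_less[OF assms(2,1)] index_less[OF assms(4,3)] by (simp add: swap_factors_def)

lemma psd_swap_factors:
  assumes "psd (a * b) X"
  shows "psd (b * a) (swap_factors a b X)"
proof -
  have "0 \<le> (\<Sum>j<b. \<Sum>i<a. \<Sum>j'<b. \<Sum>i'<a.
      cnj (v j i) * swap_factors a b X $$ (j * a + i, j' * a + i') * v j' i')" for v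
  proof -
    have "(\<Sum>j<b. \<Sum>i<a. \<Sum>j'<b. \<Sum>i'<a.
        cnj (v j i) * swap_factors a b X $$ (j * a + i, j' * a + i') * v j' i') =
      (\<Sum>j<b. \<Sum>i<a. \<Sum>j'<b. \<Sum>i'<a. cnj (v j i) * X $$ (i * b + j, i' * b + j') * v j' i')"
      by (intro sum.cong refl) (simp add: swap_factors_index)
    also have "\<dots> = (\<Sum>i<a. \<Sum>j<b. \<Sum>j'<b. \<Sum>i'<a. cnj (v j i) * X $$ (i * b + j, i' * b + j') * v j' i')"
      by (rule sum.swap)
    also have "\<dots> = (\<Sum>i<a. \<Sum>j<b. \<Sum>i'<a. \<Sum>j'<b. cnj (v j i) * X $$ (i * b + j, i' * b + j') * v j' i')"
      by (intro sum.cong refl sum.swap)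
    finally show ?thesis
      using assms by (simp add: psd_index_iff)
  qed
  then show ?thesis by (simp add: psd_index_iff swap_factors_def)
qed

lemma quantum_channel_unit_carrier:
  "quantum_channel D d E \<Longrightarrow> E (matrix_unit D a a') \<in> carrier_mat d d"
  by (simp add: quantum_channel_def linear_on_mat_def)

text \<open>Complete positivity only speaks about \<open>E \<otimes> id\<close>; the factor \<open>id \<otimes> F\<close> is obtained by
  conjugating \<open>F \<otimes> id\<close> with the swap.\<close>

lemma psd_map_tensor:
  assumes E: "quantum_channel D d E" and F: "quantum_channel D' d' F" and X: "psd (D * D') X"
  shows "psd (d * d') (map_tensor D D' d d' E F X)"
proof -
  note Ec = quantum_channel_unit_carrier[OF E] and Fc = quantum_channel_unit_carrier[OF F]
  let ?Y = "map_tensor D' D d' D F (\<lambda>Y. Y) (swap_factors D D' X)"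
  let ?R = "map_tensor D d' d d' E (\<lambda>Y. Y) (swap_factors d' D ?Y)"
  have "psd (d' * D) ?Y"
    using F psd_swap_factors[OF X] by (simp add: quantum_channel_def completely_positive_def)
  then have "psd (d * d') ?R"
    using E psd_swap_factors by (simp add: quantum_channel_def completely_positive_def)
  moreover have "map_tensor D D' d d' E F X = ?R"
  proof (rule eq_mat_index[OF map_tensor_carrier map_tensor_carrier])
    fix i j i' j' assume ij: "i < d" "j < d'" "i' < d" "j' < d'"
    have Y: "swap_factors d' D ?Y $$ (a * d' + j, a' * d' + j') =
        (\<Sum>b<D'. \<Sum>b'<D'. X $$ (a * D' + b, a' * D' + b') * F (matrix_unit D' b b') $$ (j, j'))"
      if "a < D" "a' < D" for a a'
      using that ij by (simp add: swap_factors_index map_tensor_id_index[of F, OF Fc])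
    show "map_tensor D D' d d' E F X $$ (i * d' + j, i' * d' + j') = ?R $$ (i * d' + j, i' * d' + j')"
      unfolding map_tensor_index[of E D d F D' d', OF Ec Fc ij] map_tensor_id_index[of E, OF Ec ij]
    proof (intro sum.cong refl)
      fix a a' assume "a \<in> {..<D}" "a' \<in> {..<D}"
      then have "a < D" "a' < D" by auto
      show "(\<Sum>b<D'. \<Sum>b'<D'. X $$ (a * D' + b, a' * D' + b') *
          (E (matrix_unit D a a') $$ (i, i') * F (matrix_unit D' b b') $$ (j, j'))) =
        swap_factors d' D ?Y $$ (a * d' + j, a' * d' + j') * E (matrix_unit D a a') $$ (i, i')"
        unfolding Y[OF \<open>a < D\<close> \<open>a' < D\<close>] sum_distrib_right
        by (intro sum.cong refl) (simp only: mult_ac)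
    qed
  qed
  ultimately show ?thesis by simp
qed

lemma sum_swap_four:
  fixes f :: "nat \<Rightarrow> nat \<Rightarrow> nat \<Rightarrow> nat \<Rightarrow> nat \<Rightarrow> complex"
  shows "(\<Sum>i<n. \<Sum>a<A. \<Sum>b<B. \<Sum>c<C. \<Sum>e<G. f i a b c e) = (\<Sum>a<A. \<Sum>b<B. \<Sum>c<C. \<Sum>e<G. \<Sum>i<n. f i a b c e)"
  by (subst sum.swap, rule sum.cong[OF refl])+ (rule refl)

text \<open>Trace preservation at matrix units gives Kronecker deltas, so only the diagonal entries
  of \<open>X\<close> survive the expansion.\<close>

lemma mat_trace_map_tensor:
  assumes E: "quantum_channel D d E" and F: "quantum_channel D' d' F"
    and X: "X \<in> carrier_mat (D * D') (D * D')"
  shows "mat_trace (map_tensor D D' d d' E F X) = mat_trace X"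
proof -
  note Ec = quantum_channel_unit_carrier[OF E] and Fc = quantum_channel_unit_carrier[OF F]
  have tE: "(\<Sum>i<d. E (matrix_unit D a a') $$ (i, i)) = (if a = a' then 1 else 0)" if "a < D" for a a'
    using E Ec[of a a'] mat_trace_matrix_unit[OF that, of a'] matrix_unit_carrier[of D a a']
    unfolding quantum_channel_def trace_preserving_def mat_trace_def[of "E _"] by auto
  have tF: "(\<Sum>i<d'. F (matrix_unit D' a a') $$ (i, i)) = (if a = a' then 1 else 0)" if "a < D'" for a a'
    using F Fc[of a a'] mat_trace_matrix_unit[OF that, of a'] matrix_unit_carrier[of D' a a']
    unfolding quantum_channel_def trace_preserving_def mat_trace_def[of "F _"] by auto
  let ?f = "\<lambda>i j a a' b b'. X $$ (a * D' + b, a' * D' + b') *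
      (E (matrix_unit D a a') $$ (i, i) * F (matrix_unit D' b b') $$ (j, j))"
  have "mat_trace (map_tensor D D' d d' E F X) =
      (\<Sum>i<d. \<Sum>j<d'. \<Sum>a<D. \<Sum>a'<D. \<Sum>b<D'. \<Sum>b'<D'. ?f i j a a' b b')"
    using map_tensor_carrier[of D D' d d' E F X]
    by (simp add: mat_trace_def sum_index map_tensor_index[of E D d F D' d', OF Ec Fc])
  also have "\<dots> = (\<Sum>i<d. \<Sum>a<D. \<Sum>a'<D. \<Sum>b<D'. \<Sum>b'<D'. \<Sum>j<d'. ?f i j a a' b b')"
    by (intro sum.cong refl sum_swap_four)
  also have "\<dots> = (\<Sum>a<D. \<Sum>a'<D. \<Sum>b<D'. \<Sum>b'<D'. \<Sum>i<d. \<Sum>j<d'. ?f i j a a' b b')"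
    by (rule sum_swap_four)
  also have "\<dots> = (\<Sum>a<D. \<Sum>a'<D. \<Sum>b<D'. \<Sum>b'<D'. X $$ (a * D' + b, a' * D' + b') *
      ((\<Sum>i<d. E (matrix_unit D a a') $$ (i, i)) * (\<Sum>j<d'. F (matrix_unit D' b b') $$ (j, j))))"
    by (intro sum.cong refl, subst sum_product) (simp only: sum_distrib_left)
  also have "\<dots> = (\<Sum>a<D. \<Sum>a'<D. if a = a' then \<Sum>b<D'. X $$ (a * D' + b, a * D' + b) else 0)"
    by (intro sum.cong refl) (simp add: tE tF if_distrib[of "\<lambda>x. _ * x"] cong: if_cong)
  also have "\<dots> = mat_trace X"
    using X by (simp add: mat_trace_def sum_index)
  finally show ?thesis .
qed

lemma density_map_tensor:
  assumes "quantum_channel D d E" "quantum_channel D' d' F" "density (D * D') X"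
  shows "density (d * d') (map_tensor D D' d d' E F X)"
  using assms by (simp add: density_def psd_map_tensor mat_trace_map_tensor psd_carrier)

text \<open>Conjugation by the monomial matrix with entry \<open>p i\<close> at \<open>(i, \<pi> i)\<close>.\<close>

definition monomial_channel :: "nat \<Rightarrow> (nat \<Rightarrow> complex) \<Rightarrow> (nat \<Rightarrow> nat) \<Rightarrow> complex mat \<Rightarrow> complex mat" where
  "monomial_channel m p \<pi> X = mat m m (\<lambda>(i, j). p i * cnj (p j) * X $$ (\<pi> i, \<pi> j))"

text \<open>Only matrix units are ever inserted into the two maps. Hence the identity may be
  exchanged for the monomial channel with trivial phases and permutation, although the two maps
  differ on matrices of other sizes.\<close>

lemma map_tensor_cong:
  assumes "\<And>b b'. F (matrix_unit D' b b') = G (matrix_unit D' b b')"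
  shows "map_tensor D D' d d' E F = map_tensor D D' d d' E G"
  by (simp add: map_tensor_def assms fun_eq_iff)

text \<open>The product of two monomial conjugations is again one. This serves both complete
  positivity, where the second factor is trivial, and the encoding of Bell states.\<close>

lemma map_tensor_monomial_index:
  assumes \<pi>: "\<And>i. i < m \<Longrightarrow> \<pi> i < m" and \<pi>': "\<And>i. i < m' \<Longrightarrow> \<pi>' i < m'"
    and ij: "i < m" "j < m'" "i' < m" "j' < m'"
  shows "map_tensor m m' m m' (monomial_channel m p \<pi>) (monomial_channel m' p' \<pi>') X $$ (i * m' + j, i' * m' + j') =
    (p i * p' j) * cnj (p i' * p' j') * X $$ (\<pi> i * m' + \<pi>' j, \<pi> i' * m' + \<pi>' j')"
proof -
  have car: "monomial_channel r q \<sigma> Y \<in> carrier_mat r r" for r q \<sigma> Y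
    by (simp add: monomial_channel_def)
  have entry: "monomial_channel r q \<sigma> (matrix_unit r a a') $$ (x, y) =
      (if \<sigma> x = a \<and> \<sigma> y = a' then q x * cnj (q y) else 0)"
    if "x < r" "y < r" "\<And>i. i < r \<Longrightarrow> \<sigma> i < r" for r q \<sigma> a a' x y
    using that by (simp add: monomial_channel_def)
  have "map_tensor m m' m m' (monomial_channel m p \<pi>) (monomial_channel m' p' \<pi>') X $$ (i * m' + j, i' * m' + j') =
    (\<Sum>a<m. \<Sum>a'<m. (\<Sum>b<m'. \<Sum>b'<m'. X $$ (a * m' + b, a' * m' + b') *
      (if \<pi>' j = b \<and> \<pi>' j' = b' then p' j * cnj (p' j') else 0)) *
      (if \<pi> i = a \<and> \<pi> i' = a' then p i * cnj (p i') else 0))"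
    unfolding map_tensor_index[of "monomial_channel m p \<pi>" m m "monomial_channel m' p' \<pi>'" m' m', OF car car ij]
    by (intro sum.cong refl)
      (simp add: entry ij \<pi> \<pi>' sum_distrib_left sum_distrib_right mult_ac)
  also have "\<dots> = (p i * p' j) * cnj (p i' * p' j') * X $$ (\<pi> i * m' + \<pi>' j, \<pi> i' * m' + \<pi>' j')"
    unfolding sum_pair_delta[OF \<pi>'[OF ij(2)] \<pi>'[OF ij(4)]] sum_pair_delta[OF \<pi>[OF ij(1)] \<pi>[OF ij(3)]]
    by (simp only: complex_cnj_mult mult_ac)
  finally show ?thesis .
qed

text \<open>A monomial matrix with phases of modulus one is unitary. Trace and form are therefore
  preserved up to a change of index and of vector.\<close>

lemma quantum_channel_monomial:
  assumes bij: "bij_betw \<pi> {..<m} {..<m}" and p: "\<And>i. i < m \<Longrightarrow> p i * cnj (p i) = 1"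
  shows "quantum_channel m m (monomial_channel m p \<pi>)"
proof -
  have \<pi>: "\<pi> i < m" if "i < m" for i
    using bij_betwE[OF bij] that by auto
  have "linear_on_mat m m (monomial_channel m p \<pi>)"
    by (auto simp: linear_on_mat_def monomial_channel_def \<pi> algebra_simps intro!: eq_matI)
  moreover have "trace_preserving m (monomial_channel m p \<pi>)"
  proof -
    have "(\<Sum>i<m. X $$ (\<pi> i, \<pi> i)) = (\<Sum>i<m. X $$ (i, i))" for X :: "complex mat"
      by (rule sum.reindex_bij_betw[OF bij])
    then show ?thesis by (simp add: trace_preserving_def mat_trace_def monomial_channel_def p)
  qed
  moreover have "completely_positive m m (monomial_channel m p \<pi>)"
    unfolding completely_positive_def
  proof (intro allI impI)
    fix r X assume X: "psd (m * r) X"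
    let ?R = "map_tensor m r m r (monomial_channel m p \<pi>) (\<lambda>Y. Y) X"
    have "map_tensor m r m r (monomial_channel m p \<pi>) (\<lambda>Y. Y) =
        map_tensor m r m r (monomial_channel m p \<pi>) (monomial_channel r (\<lambda>_. 1) (\<lambda>i. i))"
      by (intro map_tensor_cong) (auto simp: monomial_channel_def matrix_unit_def intro!: eq_matI)
    then have entry: "?R $$ (i * r + j, i' * r + j') =
        p i * cnj (p i') * X $$ (\<pi> i * r + j, \<pi> i' * r + j')"
      if "i < m" "j < r" "i' < m" "j' < r" for i j i' j'
      using that map_tensor_monomial_index[of m \<pi> r "\<lambda>i. i" i j i' j' p "\<lambda>_. 1" X] \<pi> by simp
    have "0 \<le> (\<Sum>i<m. \<Sum>j<r. \<Sum>i'<m. \<Sum>j'<r. cnj (v i j) * ?R $$ (i * r + j, i' * r + j') * v i' j')" for v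
    proof -
      \<comment> \<open>This is the adjoint of the monomial matrix applied to the first factor of
        \<open>v\<close>; the form of the image at \<open>v\<close> is the form of \<open>X\<close>
        at \<open>u\<close>.\<close>
      define u where "u = (\<lambda>a j. cnj (p (inv_into {..<m} \<pi> a)) * v (inv_into {..<m} \<pi> a) j)"
      have u: "u (\<pi> i) j = cnj (p i) * v i j" if "i < m" for i j
        using that bij by (simp add: u_def bij_betw_def)
      let ?g = "\<lambda>i i'. \<Sum>j<r. \<Sum>j'<r. cnj (u i j) * X $$ (i * r + j, i' * r + j') * u i' j'"
      have "(\<Sum>i<m. \<Sum>j<r. \<Sum>i'<m. \<Sum>j'<r. cnj (v i j) * ?R $$ (i * r + j, i' * r + j') * v i' j') =
          (\<Sum>i<m. \<Sum>j<r. \<Sum>i'<m. \<Sum>j'<r. cnj (u (\<pi> i) j) * X $$ (\<pi> i * r + j, \<pi> i' * r + j') * u (\<pi> i') j')"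
        by (intro sum.cong refl) (simp add: entry u mult_ac)
      also have "\<dots> = (\<Sum>i<m. \<Sum>i'<m. ?g (\<pi> i) (\<pi> i'))"
        by (intro sum.cong refl sum.swap)
      also have "\<dots> = (\<Sum>i<m. \<Sum>i'<m. ?g i (\<pi> i'))"
        by (rule sum.reindex_bij_betw[OF bij, of "\<lambda>i. \<Sum>i'<m. ?g i (\<pi> i')"])
      also have "\<dots> = (\<Sum>i<m. \<Sum>i'<m. ?g i i')"
        by (intro sum.cong refl sum.reindex_bij_betw[OF bij])
      also have "\<dots> = (\<Sum>i<m. \<Sum>j<r. \<Sum>i'<m. \<Sum>j'<r. cnj (u i j) * X $$ (i * r + j, i' * r + j') * u i' j')"
        by (intro sum.cong refl sum.swap)
      finally show ?thesis using X by (simp add: psd_index_iff)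
    qed
    then show "psd (m * r) ?R" by (simp add: psd_index_iff map_tensor_carrier)
  qed
  ultimately show ?thesis by (simp add: quantum_channel_def)
qed

section \<open>The Bell basis\<close>

definition root_unity :: "nat \<Rightarrow> complex" where
  "root_unity m = cis (2 * pi / real m)"

lemma root_unity_power: "root_unity m ^ b = cis (2 * pi * real b / real m)"
  by (simp add: root_unity_def DeMoivre mult_ac)

lemma root_unity_power_self: "m > 0 \<Longrightarrow> root_unity m ^ m = 1"
  by (simp add: root_unity_power)

lemma root_unity_cnj: "root_unity m ^ b * cnj (root_unity m ^ b) = 1"
  by (simp only: root_unity_power cis_cnj cis_mult) simp

lemma root_unity_inj:
  assumes "b < m" "b' < m" "root_unity m ^ b = root_unity m ^ b'"
  shows "b = b'"
proof -
  have "m > 0" using assms by simp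
  have "inj_on (\<lambda>k. cis (2 * pi * real k / real m)) {..<m}"
    using bij_betw_roots_unity[OF \<open>m > 0\<close>] by (simp add: bij_betw_def)
  then show ?thesis using assms by (auto simp: root_unity_power inj_on_def)
qed

lemma root_unity_power_mod:
  assumes "m > 0"
  shows "root_unity m ^ (x mod m) = root_unity m ^ x"
proof -
  have "root_unity m ^ x = root_unity m ^ (m * (x div m) + x mod m)" by simp
  also have "\<dots> = root_unity m ^ (x mod m)"
    by (simp only: power_add power_mult root_unity_power_self[OF assms] power_one mult_1)
  finally show ?thesis by simp
qed

lemma root_unity_orthogonal:
  assumes "b < m" "b' < m"
  shows "(\<Sum>v<m. root_unity m ^ (v * b) * cnj (root_unity m ^ (v * b'))) = (if b = b' then of_nat m else 0)"
proof (cases "b = b'")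
  case True
  then show ?thesis using root_unity_cnj[of m "_ * b"] by simp
next
  case False
  \<comment> \<open>This is the root of unity with exponent \<open>b - b'\<close>, written with a
    conjugate because subtraction on \<open>nat\<close> truncates. The sum is geometric in
    it.\<close>
  let ?z = "root_unity m ^ b * cnj (root_unity m ^ b')"
  have "?z \<noteq> 1"
  proof
    assume "?z = 1"
    then have "root_unity m ^ b * (root_unity m ^ b' * cnj (root_unity m ^ b')) = root_unity m ^ b'"
      by (metis mult.assoc mult.commute mult_1)
    then have "root_unity m ^ b = root_unity m ^ b'" by (simp only: root_unity_cnj mult_1_right)
    then show False using root_unity_inj[OF assms] False by simp
  qed
  have "root_unity m ^ (v * b) * cnj (root_unity m ^ (v * b')) = ?z ^ v" for v
    by (simp add: power_mult_distrib power_mult[symmetric] mult.commute)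
  moreover have "?z ^ m = 1"
  proof -
    have "m > 0" using assms by simp
    then have "(root_unity m ^ k) ^ m = 1" for k
      by (metis mult.commute power_mult power_one root_unity_power_self)
    moreover have "?z ^ m = (root_unity m ^ b) ^ m * cnj ((root_unity m ^ b') ^ m)"
      by (simp only: power_mult_distrib complex_cnj_power)
    ultimately show ?thesis by simp
  qed
  ultimately show ?thesis using False geometric_sum[OF \<open>?z \<noteq> 1\<close>, of m] by simp
qed

text \<open>Coefficients of the generalized Bell vector labelled \<open>(u, v)\<close>: the
  superposition over \<open>b\<close> of the basis vectors \<open>(b + u, b)\<close> with phases
  \<open>root_unity m ^ (v * b)\<close>. The label \<open>u\<close> is a shift and \<open>v\<close>
  a character.\<close>

definition bell_amplitude :: "nat \<Rightarrow> nat \<times> nat \<Rightarrow> nat \<Rightarrow> nat \<Rightarrow> complex" where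
  "bell_amplitude m = (\<lambda>(u, v) i b.
     if i = (b + u) mod m then root_unity m ^ (v * b) / of_real (sqrt (real m)) else 0)"

definition bell :: "nat \<Rightarrow> nat \<times> nat \<Rightarrow> complex mat" where
  "bell m z = mat (m * m) (m * m) (\<lambda>(x, y).
     bell_amplitude m z (x div m) (x mod m) * cnj (bell_amplitude m z (y div m) (y mod m)))"

lemma bell_carrier [simp]: "bell m z \<in> carrier_mat (m * m) (m * m)"
  by (simp add: bell_def)

lemma bell_index:
  assumes "i < m" "b < m" "i' < m" "b' < m"
  shows "bell m z $$ (i * m + b, i' * m + b') = bell_amplitude m z i b * cnj (bell_amplitude m z i' b')"
  using assms index_less[OF assms(1,2)] index_less[OF assms(3,4)] by (simp add: bell_def)

lemma bell_psd: "psd (m * m) (bell m z)"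
  by (rule psd_rank_one) (auto simp: bell_def)

section \<open>Translations modulo m\<close>

lemma add_mod_eq_iff:
  fixes u u' :: nat
  assumes "u < m" "u' < m"
  shows "(c + u) mod m = (c + u') mod m \<longleftrightarrow> u = u'"
proof
  assume "(c + u) mod m = (c + u') mod m"
  then have "(int c + int u) mod int m = (int c + int u') mod int m"
    by (metis of_nat_add of_nat_mod)
  then have "int u mod int m = int u' mod int m"
    by (metis add_diff_cancel_left' mod_diff_left_eq)
  then show "u = u'" using assms by (simp flip: of_nat_mod)
qed simp

lemma add_mod_eq_ex1:
  fixes i :: nat
  assumes "i < m"
  shows "\<exists>u<m. i = (c + u) mod m"
proof -
  have "c mod m < m" using assms by simp
  have "(c + (i + (m - c mod m)) mod m) mod m = (c mod m + (i + (m - c mod m))) mod m"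
    by (simp add: mod_simps)
  also have "\<dots> = (i + m) mod m"
    using \<open>c mod m < m\<close> by (intro arg_cong[where f = "\<lambda>x. x mod m"]) simp
  finally show ?thesis using assms by (intro exI[of _ "(i + (m - c mod m)) mod m"]) simp
qed

lemma sum_add_mod_delta:
  fixes i c :: nat and h :: "'a::comm_monoid_add"
  assumes "i < m"
  shows "(\<Sum>u<m. if i = (c + u) mod m then h else 0) = h"
proof -
  obtain u0 where u0: "u0 < m" "i = (c + u0) mod m" using add_mod_eq_ex1[OF assms] by blast
  have "(\<Sum>u<m. if i = (c + u) mod m then h else 0) = (\<Sum>u<m. if u = u0 then h else 0)"
    by (intro sum.cong refl) (use u0 add_mod_eq_iff[OF u0(1)] in auto)
  then show ?thesis using u0 by simp
qed

lemma bell_amplitude_norm: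
  assumes "m > 0"
  shows "(\<Sum>i<m. \<Sum>b<m. bell_amplitude m z i b * cnj (bell_amplitude m z i b)) = 1"
proof -
  obtain u v where z: "z = (u, v)" by (cases z)
  have sq: "complex_of_real (sqrt (real m)) * complex_of_real (sqrt (real m)) = of_nat m"
    by (simp flip: of_real_mult)
  have "(\<Sum>i<m. \<Sum>b<m. bell_amplitude m z i b * cnj (bell_amplitude m z i b)) =
      (\<Sum>i<m. \<Sum>b<m. if i = (u + b) mod m then 1 / of_nat m else 0)"
    using root_unity_cnj[of m] by (intro sum.cong refl) (simp add: z bell_amplitude_def sq add.commute)
  also have "\<dots> = (\<Sum>i<m. 1 / of_nat m)"
    by (intro sum.cong refl sum_add_mod_delta) simp
  finally show ?thesis using assms by simp
qed

lemma bell_density: "m > 0 \<Longrightarrow> density (m * m) (bell m z)"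
  using bell_amplitude_norm[of m z] unfolding density_def
  by (simp add: bell_psd mat_trace_def sum_index bell_index carrier_matD(1)[OF bell_carrier])

lemma bell_square_trace:
  assumes "m > 0"
  shows "mat_trace (bell m z * bell m z) = 1"
proof -
  let ?\<phi> = "\<lambda>x. bell_amplitude m z (x div m) (x mod m)"
  have n: "(\<Sum>x<m * m. ?\<phi> x * cnj (?\<phi> x)) = 1"
    using bell_amplitude_norm[OF assms, of z] by (simp add: sum_index)
  have "mat_trace (bell m z * bell m z) = (\<Sum>x<m * m. \<Sum>y<m * m. (?\<phi> x * cnj (?\<phi> x)) * (?\<phi> y * cnj (?\<phi> y)))"
    unfolding mat_trace_mult[OF bell_carrier bell_carrier]
    by (intro sum.cong refl) (simp add: bell_def mult_ac)
  also have "\<dots> = (\<Sum>x<m * m. ?\<phi> x * cnj (?\<phi> x)) * (\<Sum>x<m * m. ?\<phi> x * cnj (?\<phi> x))"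
    by (simp only: sum_product)
  finally show ?thesis by (simp only: n mult_1)
qed

text \<open>In each entry the sum over \<open>v\<close> gives \<open>m\<close> if
  \<open>b = b'\<close> and zero otherwise, by orthogonality of characters. The two shift conditions
  then force \<open>i = i'\<close>, and exactly one \<open>u\<close> meets them.\<close>

lemma bell_povm:
  assumes "m > 0"
  shows "povm (m * m) (Zmod2 m) (bell m)"
proof -
  have "mat (m * m) (m * m) (\<lambda>xy. \<Sum>z\<in>Zmod2 m. bell m z $$ xy) = 1\<^sub>m (m * m)"
  proof (rule eq_mat_index)
    fix i b i' b' assume ij: "i < m" "b < m" "i' < m" "b' < m"
    have sq: "complex_of_real (sqrt (real m)) * complex_of_real (sqrt (real m)) = of_nat m"
      by (simp flip: of_real_mult)
    have eq: "i * m + b = i' * m + b' \<longleftrightarrow> i = i' \<and> b = b'"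
      using index_div_mod[OF ij(2)] index_div_mod[OF ij(4)] by metis
    have "(\<Sum>z\<in>Zmod2 m. bell m z $$ (i * m + b, i' * m + b')) =
        (\<Sum>u<m. \<Sum>v<m. bell_amplitude m (u, v) i b * cnj (bell_amplitude m (u, v) i' b'))"
      unfolding Zmod2_def by (simp add: sum.cartesian_product bell_index[OF ij])
    also have "\<dots> = (\<Sum>u<m. \<Sum>v<m. (if i = (b + u) mod m \<and> i' = (b' + u) mod m then 1 / of_nat m else 0) *
        (root_unity m ^ (v * b) * cnj (root_unity m ^ (v * b'))))"
      by (intro sum.cong refl) (simp add: bell_amplitude_def sq)
    also have "\<dots> = (\<Sum>u<m. (if i = (b + u) mod m \<and> i' = (b' + u) mod m then 1 / of_nat m else 0) *
        (if b = b' then of_nat m else 0))"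
      by (simp only: sum_distrib_left[symmetric] root_unity_orthogonal[OF ij(2,4)])
    also have "\<dots> = (\<Sum>u<m. if i = (b + u) mod m then (if i = i' \<and> b = b' then 1 else 0) else 0)"
      using assms by (intro sum.cong refl) auto
    also have "\<dots> = (if i = i' \<and> b = b' then 1 else 0)"
      using ij by (intro sum_add_mod_delta)
    finally show "mat (m * m) (m * m) (\<lambda>xy. \<Sum>z\<in>Zmod2 m. bell m z $$ xy) $$ (i * m + b, i' * m + b') =
        1\<^sub>m (m * m) $$ (i * m + b, i' * m + b')"
      using index_less[OF ij(1,2)] index_less[OF ij(3,4)] eq by simp
  qed auto
  then show ?thesis by (simp add: povm_def bell_psd)
qed

text \<open>Senders encode by generalized Pauli matrices; the second one uses the transposed shift, so
  that the shifts add up on the maximally entangled state \<open>bell m (0, 0)\<close>.\<close>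

definition encode_left :: "nat \<Rightarrow> nat \<times> nat \<Rightarrow> complex mat \<Rightarrow> complex mat" where
  "encode_left m = (\<lambda>(q, r). monomial_channel m (\<lambda>i. root_unity m ^ (r * i)) (\<lambda>i. (m - q + i) mod m))"

definition encode_right :: "nat \<Rightarrow> nat \<times> nat \<Rightarrow> complex mat \<Rightarrow> complex mat" where
  "encode_right m = (\<lambda>(s, t). monomial_channel m (\<lambda>i. root_unity m ^ (t * i)) (\<lambda>i. (s + i) mod m))"

lemma bij_betw_add_mod: "m > 0 \<Longrightarrow> bij_betw (\<lambda>i. (c + i) mod m) {..<m} {..<m :: nat}"
  using add_mod_eq_iff[of _ m _ c] add_mod_eq_ex1[of _ m c]
  by (auto simp: bij_betw_def inj_on_def image_iff Bex_def)

lemma quantum_channel_encode: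
  assumes "m > 0"
  shows "quantum_channel m m (encode_left m x)" "quantum_channel m m (encode_right m x)"
  unfolding encode_left_def encode_right_def case_prod_beta
  by (intro quantum_channel_monomial bij_betw_add_mod assms root_unity_cnj)+

text \<open>The encoded vector is the Bell vector of the sum only up to the global phase
  \<open>root_unity m ^ (r * ?u)\<close>, which disappears in the rank-one matrix. Reading
  amplitudes at \<open>m - q + i\<close> realizes the shift by \<open>+ q\<close>.\<close>

lemma encode_bell:
  assumes "x \<in> Zmod2 m" "y \<in> Zmod2 m"
  shows "map_tensor m m m m (encode_left m x) (encode_right m y) (bell m (0, 0)) = bell m (oplus2 m x y)"
proof -
  obtain q r where x: "x = (q, r)" "q < m" "r < m" using assms(1) by (auto simp: Zmod2_def)
  obtain s t where y: "y = (s, t)" "s < m" "t < m" using assms(2) by (auto simp: Zmod2_def)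
  have m: "m > 0" using x by simp
  let ?u = "(q + s) mod m" and ?v = "(r + t) mod m"
  have amp: "root_unity m ^ (r * i) * root_unity m ^ (t * b) *
      bell_amplitude m (0, 0) ((m - q + i) mod m) ((s + b) mod m) =
      root_unity m ^ (r * ?u) * bell_amplitude m (?u, ?v) i b" if ib: "i < m" "b < m" for i b
  proof -
    \<comment> \<open>Adding \<open>q\<close> to both sides removes the subtraction, and
      cancellation modulo \<open>m\<close> shows that nothing was lost.\<close>
    have "(q + (m - q + i) mod m) mod m = i"
      using x ib by (simp add: mod_simps)
    moreover have "(q + ((s + b) mod m + 0) mod m) mod m = (b + ?u) mod m"
      by (simp add: mod_simps ac_simps)
    ultimately have iff: "(m - q + i) mod m = ((s + b) mod m + 0) mod m \<longleftrightarrow> i = (b + ?u) mod m"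
      using add_mod_eq_iff[of "(m - q + i) mod m" m "((s + b) mod m + 0) mod m" q] m by simp
    have "root_unity m ^ (r * i) * root_unity m ^ (t * b) = root_unity m ^ (r * ?u) * root_unity m ^ (?v * b)"
      if i: "i = (b + ?u) mod m"
    proof -
      have "root_unity m ^ (r * i) = (root_unity m ^ (b + ?u)) ^ r"
        unfolding i by (simp add: power_mult mult.commute[of r] root_unity_power_mod[OF m])
      moreover have "root_unity m ^ (?v * b) = (root_unity m ^ (r + t)) ^ b"
        by (simp add: power_mult root_unity_power_mod[OF m])
      ultimately show ?thesis
        by (simp add: power_mult[symmetric] power_add[symmetric] algebra_simps)
    qed
    then show ?thesis using iff by (auto simp: bell_amplitude_def)
  qed
  show ?thesis
  proof (rule eq_mat_index)
    fix i b i' b' assume ij: "i < m" "b < m" "i' < m" "b' < m"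
    have *: "(c * f) * cnj (c * g) = f * cnj g" if "c * cnj c = 1" for c f g :: complex
    proof -
      have "(c * f) * cnj (c * g) = (c * cnj c) * (f * cnj g)" by simp
      then show ?thesis using that by simp
    qed
    let ?\<psi> = "\<lambda>i b. root_unity m ^ (r * i) * root_unity m ^ (t * b) *
      bell_amplitude m (0, 0) ((m - q + i) mod m) ((s + b) mod m)"
    have "map_tensor m m m m (encode_left m x) (encode_right m y) (bell m (0, 0)) $$ (i * m + b, i' * m + b')
        = ?\<psi> i b * cnj (?\<psi> i' b')"
      using m ij unfolding x y encode_left_def encode_right_def prod.case
      by (subst map_tensor_monomial_index) (simp_all add: bell_index)
    also have "\<dots> = bell m (?u, ?v) $$ (i * m + b, i' * m + b')"
      unfolding amp[OF ij(1,2)] amp[OF ij(3,4)] bell_index[OF ij] by (rule *[OF root_unity_cnj])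
    finally show "map_tensor m m m m (encode_left m x) (encode_right m y) (bell m (0, 0)) $$ (i * m + b, i' * m + b')
        = bell m (oplus2 m x y) $$ (i * m + b, i' * m + b')"
      by (simp add: oplus2_def x y)
  qed (simp_all add: map_tensor_carrier)
qed

section \<open>Inclusions between the sets of conditional distributions\<close>

lemma prod_pairs:
  fixes g :: "nat \<Rightarrow> 'a::comm_monoid_mult"
  shows "(\<Prod>j<2 * k. g j) = (\<Prod>i<k. g (2 * i) * g (2 * i + 1))"
  by (induction k) (simp_all add: mult_ac)

text \<open>Summing over the outcomes of one party replaces its measurement by the identity, and
  what remains does not mention that party's input.\<close>

lemma nonsignaling_quantum_correlation:
  assumes "quantum_correlation X Y A B N" "finite A" "finite B"
  shows "nonsignaling X Y A B N"
proof -
  obtain D D' \<rho> M M' where \<rho>: "density (D * D') \<rho>"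
    and M: "\<And>x. x \<in> X \<Longrightarrow> povm D A (\<lambda>a. M a x)" and M': "\<And>y. y \<in> Y \<Longrightarrow> povm D' B (\<lambda>b. M' b y)"
    and N: "\<And>a b x y. a \<in> A \<Longrightarrow> b \<in> B \<Longrightarrow> x \<in> X \<Longrightarrow> y \<in> Y \<Longrightarrow>
      complex_of_real (N a b x y) = mat_trace (kron (M a x) (M' b y) * \<rho>)"
    using assms(1) unfolding quantum_correlation_def by blast
  have \<rho>c: "\<rho> \<in> carrier_mat (D * D') (D * D')" using \<rho> by (simp add: density_def psd_carrier)
  have Mc: "M a x \<in> carrier_mat D D" if "a \<in> A" "x \<in> X" for a x
    using M that by (auto simp: povm_def psd_carrier)
  have M'c: "M' b y \<in> carrier_mat D' D'" if "b \<in> B" "y \<in> Y" for b y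
    using M' that by (auto simp: povm_def psd_carrier)
  have sum_right: "(\<Sum>b\<in>B. mat_trace (kron C (M' b y) * \<rho>)) = mat_trace (kron C (1\<^sub>m D') * \<rho>)"
    if C: "C \<in> carrier_mat D D" and y: "y \<in> Y" for C y
  proof (rule mat_trace_mult_sum[OF _ _ \<rho>c])
    fix u v assume "u < D * D'" "v < D * D'"
    then show "(\<Sum>b\<in>B. kron C (M' b y) $$ (u, v)) = kron C (1\<^sub>m D') $$ (u, v)"
      by (elim index_cases) (simp add: kron_index[where b = D', OF C] M'c y sum_distrib_left[symmetric]
          povm_sum[OF M'[OF y]])
  qed (auto intro: kron_carrier C M'c y)
  have sum_left: "(\<Sum>a\<in>A. mat_trace (kron (M a x) C * \<rho>)) = mat_trace (kron (1\<^sub>m D) C * \<rho>)"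
    if C: "C \<in> carrier_mat D' D'" and x: "x \<in> X" for C x
  proof (rule mat_trace_mult_sum[OF _ _ \<rho>c])
    fix u v assume "u < D * D'" "v < D * D'"
    then show "(\<Sum>a\<in>A. kron (M a x) C $$ (u, v)) = kron (1\<^sub>m D) C $$ (u, v)"
      by (elim index_cases) (simp add: kron_index[where a = D, OF _ C] Mc x sum_distrib_right[symmetric]
          povm_sum[OF M[OF x]])
  qed (auto intro: kron_carrier C Mc x)
  have nonneg: "0 \<le> N a b x y" if "a \<in> A" "b \<in> B" "x \<in> X" "y \<in> Y" for a b x y
  proof -
    have "0 \<le> complex_of_real (N a b x y)"
      unfolding N[OF that] using M M' \<rho> that
      by (intro mat_trace_mult_nonneg[of "D * D'"] psd_kron) (auto simp: povm_def density_def)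
    then show ?thesis by (simp add: complex_nonneg_iff)
  qed
  have marg_left: "complex_of_real (\<Sum>b\<in>B. N a b x y) = mat_trace (kron (M a x) (1\<^sub>m D') * \<rho>)"
    if "a \<in> A" "x \<in> X" "y \<in> Y" for a x y
    using sum_right[OF Mc[OF that(1,2)] that(3)] that by (simp add: N)
  have marg_right: "complex_of_real (\<Sum>a\<in>A. N a b x y) = mat_trace (kron (1\<^sub>m D) (M' b y) * \<rho>)"
    if "b \<in> B" "x \<in> X" "y \<in> Y" for b x y
    using sum_left[OF M'c[OF that(1,3)] that(2)] that by (simp add: N)
  have total: "(\<Sum>a\<in>A. \<Sum>b\<in>B. N a b x y) = 1" if "x \<in> X" "y \<in> Y" for x y
  proof -
    have "complex_of_real (\<Sum>a\<in>A. \<Sum>b\<in>B. N a b x y) = (\<Sum>a\<in>A. mat_trace (kron (M a x) (1\<^sub>m D') * \<rho>))"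
      unfolding of_real_sum[of "\<lambda>a. \<Sum>b\<in>B. N a b x y"] by (intro sum.cong refl marg_left that)
    also have "\<dots> = mat_trace (kron (1\<^sub>m D) (1\<^sub>m D') * \<rho>)"
      using that by (intro sum_left) auto
    also have "\<dots> = 1"
      using \<rho> \<rho>c by (simp add: kron_one density_def)
    finally show ?thesis by (simp only: of_real_eq_1_iff)
  qed
  have "(\<Sum>b\<in>B. N a b x y) = (\<Sum>b\<in>B. N a b x y')" if "a \<in> A" "x \<in> X" "y \<in> Y" "y' \<in> Y" for a x y y'
    using marg_left[OF that(1-3)] marg_left[OF that(1,2,4)] by (metis of_real_eq_iff)
  moreover have "(\<Sum>a\<in>A. N a b x y) = (\<Sum>a\<in>A. N a b x' y)"
    if "b \<in> B" "y \<in> Y" "x \<in> X" "x' \<in> X" for b x x' y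
    using marg_right[OF that(1,3,2)] marg_right[OF that(1,4,2)] by (metis of_real_eq_iff)
  moreover have "cond_dist (X \<times> Y) (A \<times> B) (\<lambda>(a, b) (x, y). N a b x y)"
    using nonneg total by (auto simp: cond_dist_def sum.cartesian_product split_beta')
  ultimately show ?thesis
    unfolding nonsignaling_def by blast
qed

lemma set_CPE_subset_CPN: "set_CPE k W Z d \<subseteq> set_CPN k W Z d"
proof
  fix Q assume "Q \<in> set_CPE k W Z d"
  then obtain R N where *: "cond_dist (messages k d) Z R"
    "\<forall>i<k. quantum_correlation (W (2 * i)) (W (2 * i + 1)) {..<d (2 * i)} {..<d (2 * i + 1)} (N i)"
    "\<forall>z\<in>Z. \<forall>w \<in> strings k W. Q z w = (\<Sum>c \<in> messages k d. R z c *
      (\<Prod>i<k. N i (c (2 * i)) (c (2 * i + 1)) (w (2 * i)) (w (2 * i + 1))))"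
    unfolding set_CPE_def by blast
  from *(2) have "\<forall>i<k. nonsignaling (W (2 * i)) (W (2 * i + 1)) {..<d (2 * i)} {..<d (2 * i + 1)} (N i)"
    by (simp add: nonsignaling_quantum_correlation)
  with *(1,3) show "Q \<in> set_CPN k W Z d"
    unfolding set_CPN_def mem_Collect_eq by (intro exI[of _ R] exI[of _ N] conjI)
qed

text \<open>Shares of dimension one suffice: a probability distribution is a measurement with
  \<open>1 \<times> 1\<close> matrices, and its outcomes on the trivial state are
  independent.\<close>

lemma quantum_correlation_local:
  assumes P: "cond_dist X A P" and P': "cond_dist Y B P'"
  shows "quantum_correlation X Y A B (\<lambda>a b x y. P a x * P' b y)"
proof -
  let ?m = "\<lambda>r :: real. mat 1 1 (\<lambda>_. complex_of_real r)"
  have psd: "psd 1 (?m r)" if "0 \<le> r" for r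
    using that by (intro psd_rank_one[where u = "\<lambda>_. of_real (sqrt r)"]) (auto simp flip: of_real_mult)
  have povm: "povm 1 C (\<lambda>a. ?m (R a x))" if "cond_dist V C R" "x \<in> V" for V C R x
  proof -
    have "mat 1 1 (\<lambda>ij. \<Sum>a\<in>C. ?m (R a x) $$ ij) = 1\<^sub>m 1"
      using that by (intro eq_matI) (auto simp: cond_dist_def simp flip: of_real_sum)
    moreover have "psd 1 (?m (R a x))" if "a \<in> C" for a
      using \<open>cond_dist V C R\<close> \<open>x \<in> V\<close> that by (intro psd) (simp add: cond_dist_def)
    ultimately show ?thesis unfolding povm_def by blast
  qed
  have "mat_trace (kron (?m r) (?m r') * 1\<^sub>m 1) = complex_of_real (r * r')" for r r'
  proof -
    have "kron (?m r) (?m r') \<in> carrier_mat 1 1" by (simp add: kron_def)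
    then show ?thesis by (simp add: mat_trace_kron[of _ 1 _ 1]) (simp add: mat_trace_def)
  qed
  moreover have "density (1 * 1) (1\<^sub>m 1)"
    using psd_one[of 1] by (simp add: density_def mat_trace_def)
  ultimately show ?thesis
    unfolding quantum_correlation_def
    by (intro exI[of _ 1] exI[of _ "1\<^sub>m 1"] exI[of _ "\<lambda>a x. ?m (P a x)"] exI[of _ "\<lambda>b y. ?m (P' b y)"])
      (use povm[OF P] povm[OF P'] in simp)
qed

lemma set_C_subset_CPE: "set_C k W Z d \<subseteq> set_CPE k W Z d"
proof
  fix Q assume "Q \<in> set_C k W Z d"
  then obtain R P where R: "cond_dist (messages k d) Z R"
    and P: "\<And>j. j < 2 * k \<Longrightarrow> cond_dist (W j) {..<d j} (P j)"
    and Q: "\<And>z w. z \<in> Z \<Longrightarrow> w \<in> strings k W \<Longrightarrow>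
        Q z w = (\<Sum>c \<in> messages k d. R z c * (\<Prod>j<2 * k. P j (c j) (w j)))"
    unfolding set_C_def by blast
  have "quantum_correlation (W (2 * i)) (W (2 * i + 1)) {..<d (2 * i)} {..<d (2 * i + 1)}
      (\<lambda>a b x y. P (2 * i) a x * P (2 * i + 1) b y)" if "i < k" for i
    using that by (intro quantum_correlation_local P) auto
  then show "Q \<in> set_CPE k W Z d"
    unfolding set_CPE_def using R Q
    by (auto simp: prod_pairs intro!: exI[of _ R] exI[of _ "\<lambda>i a b x y. P (2 * i) a x * P (2 * i + 1) b y"])
qed

text \<open>All senders send 0 and the receiver answers \<open>z0\<close>. A supremum of reals has a
  meaning only over a nonempty set.\<close>

lemma set_C_nonempty:
  assumes "finite Z" "z0 \<in> Z" "\<And>j. j < 2 * k \<Longrightarrow> 0 < d j"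
  shows "set_C k W Z d \<noteq> {}"
proof -
  have "cond_dist (messages k d) Z (\<lambda>z c. if z = z0 then 1 else 0)"
    using assms by (simp add: cond_dist_def)
  moreover have "cond_dist (W j) {..<d j} (\<lambda>c w. if c = 0 then 1 else 0)" if "j < 2 * k" for j
    using assms(3)[OF that] by (simp add: cond_dist_def)
  ultimately have "(\<lambda>z w. \<Sum>c\<in>messages k d. (if z = z0 then 1 else 0) *
      (\<Prod>j<2 * k. if c j = 0 then 1 else 0)) \<in> set_C k W Z d"
    unfolding set_C_def mem_Collect_eq
    by (intro exI[of _ "\<lambda>z c. if z = z0 then 1 else 0"] exI[of _ "\<lambda>j c w. if c = 0 then 1 else 0"]) auto
  then show ?thesis by blast
qed

text \<open>The states are a fixed product of basis projectors and the measurement gives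
  \<open>z0\<close> with certainty.\<close>

lemma set_Q_nonempty:
  assumes "finite Z" "z0 \<in> Z" "\<And>j. j < 2 * k \<Longrightarrow> 0 < d j"
  shows "set_Q k W Z d \<noteq> {}"
proof -
  let ?D = "\<Prod>j<2 * k. d j"
  define M where "M z = (if z = z0 then 1\<^sub>m ?D else 0\<^sub>m ?D ?D :: complex mat)" for z
  define T where "T = tensor (2 * k) (\<lambda>j. matrix_unit (d j) 0 0)"
  have "(\<Sum>z\<in>Z. M z $$ (i, j)) = 1\<^sub>m ?D $$ (i, j)" if "i < ?D" "j < ?D" for i j
    using that by (simp add: sum.remove[OF assms(1,2)] M_def)
  then have "mat ?D ?D (\<lambda>ij. \<Sum>z\<in>Z. M z $$ ij) = 1\<^sub>m ?D"
    by (intro eq_matI) auto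
  then have M: "povm ?D Z M"
    by (simp add: povm_def M_def psd_one psd_zero)
  have dens: "density (d j) (matrix_unit (d j) 0 0)" if "j < 2 * k" for j
  proof -
    have "psd (d j) (matrix_unit (d j) 0 0)"
      by (rule psd_rank_one[where u = "\<lambda>i. if i = 0 then 1 else 0"]) auto
    then show ?thesis using assms(3)[OF that] by (simp add: density_def mat_trace_matrix_unit)
  qed
  have T: "density ?D T"
    unfolding T_def by (intro tensor_density dens)
  \<comment> \<open>Membership is an equation between complex numbers, so the trace has to be
    real.\<close>
  have "complex_of_real (Re (mat_trace (M z * T))) = mat_trace (M z * T)" if "z \<in> Z" for z
    using povm_prob_le_one(1)[OF M assms(1) that T] by (simp add: complex_nonneg_iff complex_eq_iff)
  then have "(\<lambda>z w. Re (mat_trace (M z * T))) \<in> set_Q k W Z d"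
    unfolding set_Q_def mem_Collect_eq using M dens
    by (intro exI[of _ M] exI[of _ "\<lambda>j x. matrix_unit (d j) 0 0"]) (simp add: T_def)
  then show ?thesis by blast
qed

section \<open>Upper bounds on the success probability\<close>

abbreviation (input) inputs :: "nat \<Rightarrow> nat \<Rightarrow> (nat \<times> nat) set" where
  "inputs m \<equiv> (\<lambda>j. Zmod2 m)"

abbreviation (input) outputs :: "nat \<Rightarrow> nat \<Rightarrow> (nat \<Rightarrow> nat \<times> nat) set" where
  "outputs k m \<equiv> PiE {..<k} (\<lambda>i. Zmod2 m)"

abbreviation (input) target :: "nat \<Rightarrow> nat \<Rightarrow> (nat \<Rightarrow> nat \<times> nat) \<Rightarrow> nat \<Rightarrow> nat \<times> nat" where
  "target k m \<equiv> product_fun k (\<lambda>i. oplus2 m)"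

lemma finite_Zmod2 [simp]: "finite (Zmod2 m)"
  by (simp add: Zmod2_def)

lemma card_Zmod2: "card (Zmod2 m) = m\<^sup>2"
  by (simp add: Zmod2_def power2_eq_square)

lemma finite_outputs [simp]: "finite (outputs k m)"
  by (intro finite_PiE) auto

lemma oplus2_in_Zmod2: "x \<in> Zmod2 m \<Longrightarrow> oplus2 m x y \<in> Zmod2 m"
  by (cases x; cases y) (auto simp: Zmod2_def oplus2_def)

lemma strings_in: "w \<in> strings k W \<Longrightarrow> j < 2 * k \<Longrightarrow> w j \<in> W j"
  by (auto simp: strings_def)

lemma strings_inputs: "w \<in> strings k (inputs m) \<Longrightarrow> j < 2 * k \<Longrightarrow> w j \<in> Zmod2 m"
  by (rule strings_in)

lemma target_in_outputs: "w \<in> strings k (inputs m) \<Longrightarrow> target k m w \<in> outputs k m"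
  by (auto simp: product_fun_def intro!: oplus2_in_Zmod2 strings_inputs)

lemma oplus2_right_cancel:
  assumes "x \<in> Zmod2 m" "x' \<in> Zmod2 m" "oplus2 m x y = oplus2 m x' y"
  shows "x = x'"
  using assms add_mod_eq_iff[of _ m]
  by (cases x; cases x'; cases y) (simp add: Zmod2_def oplus2_def add.commute)

text \<open>Counting from 0, the second sender of pair \<open>i\<close> is \<open>2 * i + 1\<close>.
  The tuple is reindexed by pairs and thus ranges over the same set as the outputs.\<close>

abbreviation (input) odd_inputs :: "nat \<Rightarrow> (nat \<Rightarrow> 'w) \<Rightarrow> nat \<Rightarrow> 'w" where
  "odd_inputs k w \<equiv> (\<lambda>i\<in>{..<k}. w (2 * i + 1))"

lemma outputs_in: "z \<in> outputs k m \<Longrightarrow> i < k \<Longrightarrow> z i \<in> Zmod2 m"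
  by auto

lemma odd_inputs_in_outputs: "w \<in> strings k (inputs m) \<Longrightarrow> odd_inputs k w \<in> outputs k m"
  by (auto intro!: strings_inputs)

text \<open>In a group the sum and one summand determine the other. The sum over inputs can
  therefore be rewritten as a sum over pairs of an output and a tuple of odd inputs.\<close>

lemma inj_on_target_odd_inputs:
  "inj_on (\<lambda>w. (target k m w, odd_inputs k w)) (strings k (inputs m))"
proof (rule inj_onI)
  fix w w' assume w: "w \<in> strings k (inputs m)" "w' \<in> strings k (inputs m)"
    and "(target k m w, odd_inputs k w) = (target k m w', odd_inputs k w')"
  then have eq: "target k m w = target k m w'" "odd_inputs k w = odd_inputs k w'" by simp_all
  have odd: "w (2 * i + 1) = w' (2 * i + 1)" if "i < k" for i
    using fun_cong[OF eq(2), of i] that by simp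
  have even: "w (2 * i) = w' (2 * i)" if "i < k" for i
  proof (rule oplus2_right_cancel)
    show "w (2 * i) \<in> Zmod2 m" "w' (2 * i) \<in> Zmod2 m" using w that by (auto intro: strings_inputs)
    show "oplus2 m (w (2 * i)) (w (2 * i + 1)) = oplus2 m (w' (2 * i)) (w (2 * i + 1))"
      using fun_cong[OF eq(1), of i] odd[OF that] that by (simp add: product_fun_def)
  qed
  show "w = w'"
  proof (rule PiE_ext)
    fix j assume "j \<in> {..<2 * k}"
    then show "w j = w' j"
      using odd[of "j div 2"] even[of "j div 2"] by (cases "even j") auto
  qed (use w in \<open>auto simp: strings_def\<close>)
qed

text \<open>\<open>G z y\<close> bounds the probability of output \<open>z\<close> when the odd senders have inputs \<open>y\<close>,
  uniformly over the inputs of the even senders. For fixed \<open>y\<close>, each output is the correct one for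
  exactly one input of the even senders.\<close>

lemma success_prob_le:
  assumes "m > 0"
    and G: "\<And>z y. z \<in> outputs k m \<Longrightarrow> y \<in> outputs k m \<Longrightarrow> 0 \<le> G z y"
    and Q: "\<And>w. w \<in> strings k (inputs m) \<Longrightarrow> Q (target k m w) w \<le> G (target k m w) (odd_inputs k w)"
    and sum: "\<And>y. y \<in> outputs k m \<Longrightarrow> (\<Sum>z\<in>outputs k m. G z y) \<le> real m ^ k"
  shows "success_prob k (inputs m) (target k m) Q \<le> (1 / real m) ^ k"
proof -
  let ?S = "strings k (inputs m)" and ?f = "target k m"
  have "(\<Sum>w\<in>?S. Q (?f w) w) \<le> (\<Sum>w\<in>?S. case (?f w, odd_inputs k w) of (z, y) \<Rightarrow> G z y)"
    using Q by (intro sum_mono) simp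
  also have "\<dots> = (\<Sum>(z, y)\<in>(\<lambda>w. (?f w, odd_inputs k w)) ` ?S. G z y)"
    by (rule sum.reindex[OF inj_on_target_odd_inputs, unfolded comp_def, symmetric])
  \<comment> \<open>Nonnegativity of \<open>G\<close> permits enlarging the image to the full
    product set.\<close>
  also have "\<dots> \<le> (\<Sum>(z, y)\<in>outputs k m \<times> outputs k m. G z y)"
  proof (rule sum_mono2)
    show "(\<lambda>w. (?f w, odd_inputs k w)) ` ?S \<subseteq> outputs k m \<times> outputs k m"
      by (intro image_subsetI SigmaI target_in_outputs odd_inputs_in_outputs)
  qed (use G in auto)
  also have "\<dots> = (\<Sum>y\<in>outputs k m. \<Sum>z\<in>outputs k m. G z y)"
    unfolding sum.cartesian_product[symmetric] by (rule sum.swap)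
  also have "\<dots> \<le> (\<Sum>y\<in>outputs k m. real m ^ k)"
    by (intro sum_mono sum)
  also have "\<dots> = real m ^ (2 * k) * real m ^ k"
    by (simp add: card_PiE card_Zmod2 power_mult)
  finally have "(\<Sum>w\<in>?S. Q (?f w) w) \<le> real m ^ (2 * k) * real m ^ k" .
  moreover have "(\<Prod>j<2 * k. real (card (inputs m j))) = real m ^ (2 * k) * real m ^ (2 * k)"
    by (simp add: card_Zmod2 power_mult[symmetric] power_add[symmetric])
  ultimately have "success_prob k (inputs m) ?f Q \<le>
      1 / (real m ^ (2 * k) * real m ^ (2 * k)) * (real m ^ (2 * k) * real m ^ k)"
    unfolding success_prob_def by (simp only:) (intro mult_left_mono, auto)
  also have "\<dots> = (1 / real m) ^ k"
    using assms(1) by (simp add: mult_2 power_add power_one_over)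
  finally show ?thesis .
qed

lemma success_prob_le_one:
  assumes "\<And>j. j < 2 * k \<Longrightarrow> finite (W j)" "\<And>w. w \<in> strings k W \<Longrightarrow> Q (f w) w \<le> 1"
  shows "success_prob k W f Q \<le> 1"
proof -
  have "(\<Sum>w\<in>strings k W. Q (f w) w) \<le> real (card (strings k W))"
    using sum_bounded_above[of "strings k W" "\<lambda>w. Q (f w) w" 1] assms(2) by simp
  also have "\<dots> = (\<Prod>j<2 * k. real (card (W j)))"
    by (simp add: strings_def card_PiE)
  finally have "success_prob k W f Q \<le> 1 / (\<Prod>j<2 * k. real (card (W j))) * (\<Prod>j<2 * k. real (card (W j)))"
    unfolding success_prob_def by (intro mult_left_mono) (simp_all add: prod_nonneg)
  also have "\<dots> \<le> 1" by simp
  finally show ?thesis .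
qed

text \<open>Domination between factors passes to tensor products and then to traces against
  \<open>M z\<close>. Completeness of the measurement reduces the sum over outputs to the trace of
  \<open>T y\<close>, in which every identity counts \<open>m\<close> and every state counts
  1.\<close>

lemma success_prob_set_Q:
  assumes "m > 0" "Q \<in> set_Q k (inputs m) (outputs k m) (\<lambda>j. m)"
  shows "success_prob k (inputs m) (target k m) Q \<le> (1 / real m) ^ k"
proof -
  let ?D = "\<Prod>j<2 * k. m"
  obtain M \<rho> where M: "povm ?D (outputs k m) M"
    and \<rho>: "\<And>j x. j < 2 * k \<Longrightarrow> x \<in> Zmod2 m \<Longrightarrow> density m (\<rho> j x)"
    and Q: "\<And>z w. z \<in> outputs k m \<Longrightarrow> w \<in> strings k (inputs m) \<Longrightarrow>
      complex_of_real (Q z w) = mat_trace (M z * tensor (2 * k) (\<lambda>j. \<rho> j (w j)))"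
    using assms(2) unfolding set_Q_def by blast
  define \<sigma> where "\<sigma> y j = (if even j then 1\<^sub>m m else \<rho> j (y (j div 2)))" for y j
  define T where "T y = tensor (2 * k) (\<sigma> y)" for y
  have Mpsd: "psd ?D (M z)" if "z \<in> outputs k m" for z
    using M that by (simp add: povm_def)
  have \<sigma>psd: "psd m (\<sigma> y j)" if "y \<in> outputs k m" "j < 2 * k" for y j
  proof (cases "even j")
    case True
    then show ?thesis by (simp add: \<sigma>_def psd_one)
  next
    case False
    have "density m (\<rho> j (y (j div 2)))"
      using that by (intro \<rho> outputs_in[OF that(1)]) auto
    then show ?thesis using False by (simp add: \<sigma>_def density_def)
  qed
  have Tpsd: "psd ?D (T y)" if "y \<in> outputs k m" for y
    unfolding T_def using \<sigma>psd[OF that] by (intro tensor_psd)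
  show ?thesis
  proof (rule success_prob_le[OF assms(1), where G = "\<lambda>z y. Re (mat_trace (M z * T y))"])
    show "0 \<le> Re (mat_trace (M z * T y))" if "z \<in> outputs k m" "y \<in> outputs k m" for z y
      using mat_trace_mult_nonneg[OF Mpsd[OF that(1)] Tpsd[OF that(2)]] by (simp add: complex_nonneg_iff)
  next
    fix w assume w: "w \<in> strings k (inputs m)"
    let ?z = "target k m w" and ?y = "odd_inputs k w"
    let ?R = "tensor (2 * k) (\<lambda>j. \<rho> j (w j))"
    have z: "?z \<in> outputs k m" by (rule target_in_outputs[OF w])
    have y: "?y \<in> outputs k m" by (rule odd_inputs_in_outputs[OF w])
    have dens: "density m (\<rho> j (w j))" if "j < 2 * k" for j
      using \<rho>[OF that] strings_in[OF w that] by simp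
    \<comment> \<open>At even positions the difference is positive because a state has trace one; at
      odd positions it is zero.\<close>
    have "psd m (\<sigma> ?y j - \<rho> j (w j))" if j: "j < 2 * k" for j
    proof (cases "even j")
      case True
      then show ?thesis using dens[OF j] by (simp add: \<sigma>_def density_def psd_trace_bound)
    next
      case False
      moreover have "j div 2 < k" using j by auto
      ultimately have "\<sigma> ?y j = \<rho> j (w j)" by (simp add: \<sigma>_def)
      moreover have "\<rho> j (w j) - \<rho> j (w j) = 0\<^sub>m m m"
        using dens[OF j] by (intro minus_r_inv_mat) (simp add: density_def psd_carrier)
      ultimately show ?thesis by (simp add: psd_zero)
    qed
    then have "psd ?D (T ?y - ?R)"
      unfolding T_def using dens \<sigma>psd[OF y] by (intro tensor_mono) (auto simp: density_def)
    then have "0 \<le> mat_trace (M ?z * (T ?y - ?R))"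
      by (rule mat_trace_mult_nonneg[OF Mpsd[OF z]])
    also have "\<dots> = mat_trace (M ?z * T ?y) - mat_trace (M ?z * ?R)"
    proof -
      have R: "?R \<in> carrier_mat ?D ?D"
        using dens by (intro tensor_carrier) (auto simp: density_def psd_carrier)
      note c = psd_carrier[OF Mpsd[OF z]] psd_carrier[OF Tpsd[OF y]]
      have "T ?y - ?R \<in> carrier_mat ?D ?D" using R by (rule minus_carrier_mat)
      then show ?thesis
        using c R unfolding mat_trace_mult[OF c] mat_trace_mult[OF c(1) R]
        by (subst mat_trace_mult[OF c(1)]) (simp_all add: right_diff_distrib sum_subtractf)
    qed
    also have "mat_trace (M ?z * ?R) = complex_of_real (Q ?z w)"
      by (rule Q[OF z w, symmetric])
    finally show "Q ?z w \<le> Re (mat_trace (M ?z * T ?y))"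
      by (simp only: complex_nonneg_iff minus_complex.sel Re_complex_of_real diff_ge_0_iff_ge)
  next
    fix y assume y: "y \<in> outputs k m"
    have "mat_trace (T y) = (\<Prod>j<2 * k. mat_trace (\<sigma> y j))"
      unfolding T_def using \<sigma>psd[OF y] by (intro mat_trace_tensor) (rule psd_carrier)
    also have "\<dots> = (\<Prod>i<k. of_nat m)"
      unfolding prod_pairs
    proof (intro prod.cong refl)
      fix i assume "i \<in> {..<k}"
      then have "mat_trace (\<rho> (2 * i + 1) (y i)) = 1"
        using \<rho>[of "2 * i + 1" "y i"] outputs_in[OF y, of i] by (simp add: density_def)
      then show "mat_trace (\<sigma> y (2 * i)) * mat_trace (\<sigma> y (2 * i + 1)) = of_nat m"
        by (simp add: \<sigma>_def) (simp add: mat_trace_def)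
    qed
    finally have "(\<Sum>z\<in>outputs k m. mat_trace (M z * T y)) = of_nat m ^ k"
      using povm_trace_sum[OF M psd_carrier[OF Tpsd[OF y]]] by simp
    then have "Re (\<Sum>z\<in>outputs k m. mat_trace (M z * T y)) = real m ^ k"
      by (metis Re_complex_of_real of_nat_power of_real_of_nat_eq)
    then show "(\<Sum>z\<in>outputs k m. Re (mat_trace (M z * T y))) \<le> real m ^ k" by simp
  qed
qed

text \<open>A nonnegative \<open>N i\<close> is at most its sum over the first output, and
  nonsignaling makes this sum independent of the first input.\<close>

lemma success_prob_set_CPN:
  assumes "m > 0" "Q \<in> set_CPN k (inputs m) (outputs k m) (\<lambda>j. m)"
  shows "success_prob k (inputs m) (target k m) Q \<le> (1 / real m) ^ k"
proof -
  let ?C = "messages k (\<lambda>j. m)"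
  obtain R N where R: "cond_dist ?C (outputs k m) R"
    and N: "\<And>i. i < k \<Longrightarrow> nonsignaling (Zmod2 m) (Zmod2 m) {..<m} {..<m} (N i)"
    and Q: "\<And>z w. z \<in> outputs k m \<Longrightarrow> w \<in> strings k (inputs m) \<Longrightarrow>
      Q z w = (\<Sum>c\<in>?C. R z c * (\<Prod>i<k. N i (c (2 * i)) (c (2 * i + 1)) (w (2 * i)) (w (2 * i + 1))))"
    using assms(2) unfolding set_CPN_def by blast
  \<comment> \<open>The input \<open>(0, 0)\<close> of the first sender is an arbitrary choice;
    nonsignaling gives the same marginal for every other input.\<close>
  define N' where "N' i b y = (\<Sum>a<m. N i a b (0, 0) y)" for i b y
  define G where "G z y = (\<Sum>c\<in>?C. R z c * (\<Prod>i<k. N' i (c (2 * i + 1)) (y i)))" for z and y :: "nat \<Rightarrow> nat \<times> nat"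
  have x0: "(0, 0) \<in> Zmod2 m" using assms(1) by (simp add: Zmod2_def)
  have Npos: "0 \<le> N i a b x y" if "i < k" "a < m" "b < m" "x \<in> Zmod2 m" "y \<in> Zmod2 m" for i a b x y
    using N[OF that(1)] that unfolding nonsignaling_def cond_dist_def by auto
  have N'pos: "0 \<le> N' i b y" if "i < k" "b < m" "y \<in> Zmod2 m" for i b y
    unfolding N'_def using that x0 by (intro sum_nonneg Npos) auto
  have N'sum: "(\<Sum>b<m. N' i b y) = 1" if "i < k" "y \<in> Zmod2 m" for i y
  proof -
    have "(\<Sum>b<m. N' i b y) = (\<Sum>a<m. \<Sum>b<m. N i a b (0, 0) y)"
      unfolding N'_def by (rule sum.swap)
    also have "\<dots> = 1"
    proof -
      have "cond_dist (Zmod2 m \<times> Zmod2 m) ({..<m} \<times> {..<m}) (\<lambda>(a, b) (x, y). N i a b x y)"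
        using N[OF that(1)] by (simp add: nonsignaling_def)
      then have "(\<Sum>(a, b)\<in>{..<m} \<times> {..<m}. N i a b (0, 0) y) = 1"
        unfolding cond_dist_def using bspec[of _ _ "((0, 0), y)"] that(2) x0 by (fastforce simp: split_beta')
      then show ?thesis by (simp add: sum.cartesian_product)
    qed
    finally show ?thesis .
  qed
  have N_le: "N i a b x y \<le> N' i b y"
    if "i < k" "a < m" "b < m" "x \<in> Zmod2 m" "y \<in> Zmod2 m" for i a b x y
  proof -
    have "N i a b x y \<le> (\<Sum>a<m. N i a b x y)"
      using that by (intro member_le_sum Npos) auto
    also have "\<dots> = N' i b y"
      using N[OF that(1)] that x0 unfolding nonsignaling_def N'_def by blast
    finally show ?thesis .
  qed
  have Rpos: "0 \<le> R z c" if "z \<in> outputs k m" "c \<in> ?C" for z c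
    using R that by (auto simp: cond_dist_def)
  have c: "c (2 * i) < m" "c (2 * i + 1) < m" if "c \<in> ?C" "i < k" for c i
    using strings_in[OF that(1), of "2 * i"] strings_in[OF that(1), of "2 * i + 1"] that(2) by auto
  show ?thesis
  proof (rule success_prob_le[OF assms(1), where G = G])
    show "0 \<le> G z y" if "z \<in> outputs k m" "y \<in> outputs k m" for z y
      unfolding G_def using that by (intro sum_nonneg mult_nonneg_nonneg prod_nonneg Rpos N'pos c(2) outputs_in[OF that(2)]) simp_all
  next
    fix w assume w: "w \<in> strings k (inputs m)"
    note z = target_in_outputs[OF w]
    have wi: "w (2 * i) \<in> Zmod2 m" "w (2 * i + 1) \<in> Zmod2 m" if "i < k" for i
      using that w by (auto intro: strings_inputs)
    show "Q (target k m w) w \<le> G (target k m w) (odd_inputs k w)"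
      unfolding Q[OF z w] G_def
    proof (intro sum_mono mult_left_mono prod_mono Rpos z conjI)
      fix c i assume ci: "c \<in> ?C" "i \<in> {..<k}"
      then have i: "i < k" by simp
      show "0 \<le> N i (c (2 * i)) (c (2 * i + 1)) (w (2 * i)) (w (2 * i + 1))"
        by (intro Npos i c wi ci)
      show "N i (c (2 * i)) (c (2 * i + 1)) (w (2 * i)) (w (2 * i + 1)) \<le> N' i (c (2 * i + 1)) (odd_inputs k w i)"
        using N_le[OF i c(1)[OF ci(1) i] c(2)[OF ci(1) i] wi(1)[OF i] wi(2)[OF i]] i by simp
    qed
  next
    fix y assume y: "y \<in> outputs k m"
    have "(\<Sum>z\<in>outputs k m. G z y) = (\<Sum>c\<in>?C. \<Sum>z\<in>outputs k m. R z c * (\<Prod>i<k. N' i (c (2 * i + 1)) (y i)))"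
      unfolding G_def by (rule sum.swap)
    also have "\<dots> = (\<Sum>c\<in>?C. \<Prod>i<k. N' i (c (2 * i + 1)) (y i))"
      using R by (intro sum.cong refl) (simp add: sum_distrib_right[symmetric] cond_dist_def)
    \<comment> \<open>Padding with factors 1 for the first senders makes the sum over messages
      factor. Even positions then give \<open>m\<close> each, odd positions the total mass 1 of
      \<open>N'\<close>.\<close>
    also have "\<dots> = (\<Sum>c\<in>?C. \<Prod>j<2 * k. if even j then 1 else N' (j div 2) (c j) (y (j div 2)))"
      by (simp add: prod_pairs)
    also have "\<dots> = (\<Prod>j<2 * k. \<Sum>b<m. if even j then 1 else N' (j div 2) b (y (j div 2)))"
      unfolding strings_def by (intro prod_sum_PiE[symmetric]) auto
    also have "\<dots> = (\<Prod>i<k. real m)"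
      unfolding prod_pairs by (intro prod.cong refl) (simp add: N'sum outputs_in[OF y])
    finally show "(\<Sum>z\<in>outputs k m. G z y) \<le> real m ^ k" by simp
  qed
qed

section \<open>Superdense coding\<close>

text \<open>Channels send each shared state to a state, so \<open>Q\<close> is an outcome
  probability. This bounds the supremum that superdense coding attains.\<close>

lemma set_QPE_le_one:
  assumes "Q \<in> set_QPE k W Z d" "finite Z" "z \<in> Z" "w \<in> strings k W"
  shows "Q z w \<le> 1"
proof -
  obtain M D \<rho> E where M: "povm (\<Prod>j<2 * k. d j) Z M"
    and \<rho>: "\<And>i. i < k \<Longrightarrow> density (D (2 * i) * D (2 * i + 1)) (\<rho> i)"
    and E: "\<And>j x. j < 2 * k \<Longrightarrow> x \<in> W j \<Longrightarrow> quantum_channel (D j) (d j) (E j x)"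
    and Q: "complex_of_real (Q z w) = mat_trace (M z * tensor k (\<lambda>i.
          map_tensor (D (2 * i)) (D (2 * i + 1)) (d (2 * i)) (d (2 * i + 1))
            (E (2 * i) (w (2 * i))) (E (2 * i + 1) (w (2 * i + 1))) (\<rho> i)))"
    using assms unfolding set_QPE_def by blast
  have "density (\<Prod>j<2 * k. d j) (tensor k (\<lambda>i.
      map_tensor (D (2 * i)) (D (2 * i + 1)) (d (2 * i)) (d (2 * i + 1))
        (E (2 * i) (w (2 * i))) (E (2 * i + 1) (w (2 * i + 1))) (\<rho> i)))"
    unfolding prod_pairs using assms(4)
    by (intro tensor_density density_map_tensor E \<rho>) (auto intro!: strings_in)
  from povm_prob_le_one(2)[OF M assms(2,3) this] show ?thesis
    unfolding Q[symmetric] by (simp add: less_eq_complex_def)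
qed

lemma superdense_coding:
  assumes "m > 0"
  obtains Q where "Q \<in> set_QPE k (inputs m) (outputs k m) (\<lambda>j. m)"
    "success_prob k (inputs m) (target k m) Q = 1"
proof -
  define M where "M z = tensor k (\<lambda>i. bell m (z i))" for z :: "nat \<Rightarrow> nat \<times> nat"
  define E where "E j = (if even j then encode_left m else encode_right m)" for j :: nat
  define T where "T w = tensor k (\<lambda>i. map_tensor m m m m (E (2 * i) (w (2 * i)))
    (E (2 * i + 1) (w (2 * i + 1))) (bell m (0, 0)))" for w
  define Q where "Q z w = Re (mat_trace (M z * T w))" for z w
  \<comment> \<open>The dimension is declared per sender, whereas states and measurement are tensor
    products over pairs.\<close>
  have D: "(\<Prod>j<2 * k. m) = (\<Prod>i<k. m * m)" by (rule prod_pairs)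
  have M: "povm (\<Prod>j<2 * k. m) (outputs k m) M"
    unfolding M_def D by (intro tensor_povm bell_povm assms finite_Zmod2)
  have chan: "quantum_channel m m (E j x)" for j x
    by (simp add: E_def quantum_channel_encode assms)
  have T: "density (\<Prod>j<2 * k. m) (T w)" for w
    unfolding T_def D by (intro tensor_density density_map_tensor chan bell_density assms)
  \<comment> \<open>The received state is itself the measurement element of the correct output. As
    this is a product of Bell projectors, the trace of its square is 1.\<close>
  have T_eq: "T w = M (target k m w)" if w: "w \<in> strings k (inputs m)" for w
    unfolding T_def M_def
  proof (rule tensor_cong)
    fix i assume "i < k"
    then show "map_tensor m m m m (E (2 * i) (w (2 * i))) (E (2 * i + 1) (w (2 * i + 1))) (bell m (0, 0)) =
        bell m (target k m w i)"
      using encode_bell[of "w (2 * i)" m "w (2 * i + 1)"] strings_in[OF w, of "2 * i"]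
        strings_in[OF w, of "2 * i + 1"] by (simp add: E_def product_fun_def)
  qed
  have QPE: "Q \<in> set_QPE k (inputs m) (outputs k m) (\<lambda>j. m)"
    unfolding set_QPE_def mem_Collect_eq
  proof (intro exI[of _ M] exI[of _ "\<lambda>_. m"] exI[of _ "\<lambda>_. bell m (0, 0)"] exI[of _ E] conjI M allI impI ballI)
    fix z w assume "z \<in> outputs k m" "w \<in> strings k (inputs m)"
    then have "0 \<le> mat_trace (M z * T w)"
      using povm_prob_le_one(1)[OF M finite_outputs _ T] by blast
    then show "complex_of_real (Q z w) = mat_trace (M z * tensor k (\<lambda>i. map_tensor m m m m
        (E (2 * i) (w (2 * i))) (E (2 * i + 1) (w (2 * i + 1))) (bell m (0, 0))))"
      by (simp add: Q_def T_def complex_nonneg_iff complex_eq_iff)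
  qed (simp_all add: chan bell_density assms)
  have "Q (target k m w) w = 1" if w: "w \<in> strings k (inputs m)" for w
  proof -
    have "mat_trace (M z * M z) = 1" for z
    proof -
      have "M z * M z = tensor k (\<lambda>i. bell m (z i) * bell m (z i))"
        unfolding M_def by (rule tensor_mult[where d = "\<lambda>_. m * m"]) auto
      moreover have "mat_trace (tensor k (\<lambda>i. bell m (z i) * bell m (z i))) =
          (\<Prod>i<k. mat_trace (bell m (z i) * bell m (z i)))"
        by (rule mat_trace_tensor[where d = "\<lambda>_. m * m"]) (intro mult_carrier_mat[of _ "m * m" "m * m"] bell_carrier)
      ultimately show ?thesis by (simp add: bell_square_trace assms)
    qed
    then show ?thesis by (simp add: Q_def T_eq[OF w])
  qed
  then have "success_prob k (inputs m) (target k m) Q = 1"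
    using assms by (simp add: success_prob_def strings_def card_PiE card_Zmod2)
  with QPE show ?thesis by (rule that)
qed

theorem theorem4:
  fixes n k :: nat
  assumes "n > 0" and "k > 0"
  shows "let W = (\<lambda>j::nat. Zmod2 (2 ^ n));
             Z = PiE {..<k} (\<lambda>i. Zmod2 (2 ^ n));
             d = (\<lambda>j::nat. 2 ^ n);
             f = product_fun k (\<lambda>i. oplus2 (2 ^ n));
             PS = max_success_prob k W f
         in PS (set_QPE k W Z d) = 1
          \<and> 1 > (1 / 2 ^ n :: real) ^ k
          \<and> (1 / 2 ^ n) ^ k \<ge> max (PS (set_Q k W Z d)) (PS (set_CPN k W Z d))
          \<and> max (PS (set_Q k W Z d)) (PS (set_CPN k W Z d)) \<ge> PS (set_CPE k W Z d)
          \<and> PS (set_CPE k W Z d) \<ge> PS (set_C k W Z d)"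
proof -
  define m :: nat where "m = 2 ^ n"
  have m: "m > 0" by (simp add: m_def)
  let ?S = "success_prob k (inputs m) (target k m)"
  let ?PS = "max_success_prob k (inputs m) (target k m)"
  let ?C = "set_C k (inputs m) (outputs k m) (\<lambda>j. m)"
  let ?Q = "set_Q k (inputs m) (outputs k m) (\<lambda>j. m)"
  let ?CPE = "set_CPE k (inputs m) (outputs k m) (\<lambda>j. m)"
  let ?CPN = "set_CPN k (inputs m) (outputs k m) (\<lambda>j. m)"
  let ?QPE = "set_QPE k (inputs m) (outputs k m) (\<lambda>j. m)"
  have zero: "(\<lambda>i\<in>{..<k}. (0, 0)) \<in> outputs k m" using m by (auto simp: Zmod2_def)
  have C: "?C \<noteq> {}" and Q: "?Q \<noteq> {}"
    by (intro set_C_nonempty[OF finite_outputs zero] set_Q_nonempty[OF finite_outputs zero] m)+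
  have CPE: "?CPE \<noteq> {}" using C set_C_subset_CPE by blast
  have CPN: "?CPN \<noteq> {}" using CPE set_CPE_subset_CPN by blast
  \<comment> \<open>One bound serves every supremum comparison below, since the other two classical
    sets lie inside this one.\<close>
  have bdd: "bdd_above (?S ` ?CPN)"
    using success_prob_set_CPN[OF m] by (intro bdd_aboveI2)
  have QPE_le: "?S Q \<le> 1" if "Q \<in> ?QPE" for Q
    by (intro success_prob_le_one finite_Zmod2 set_QPE_le_one[OF that finite_outputs] target_in_outputs)
  obtain Q0 where Q0: "Q0 \<in> ?QPE" "?S Q0 = 1" using superdense_coding[OF m] .
  \<comment> \<open>The supremum is attained at \<open>Q0\<close>.\<close>
  have "?PS ?QPE = 1"
    unfolding max_success_prob_def
    using Q0 QPE_le by (intro cSup_eq_maximum) force+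
  moreover have "(1 / real m) ^ k < 1"
    using assms by (simp add: m_def power_less_one_iff power_one_over one_less_power)
  moreover have "?PS ?Q \<le> (1 / real m) ^ k"
    unfolding max_success_prob_def by (intro cSUP_least Q success_prob_set_Q m)
  moreover have "?PS ?CPN \<le> (1 / real m) ^ k"
    unfolding max_success_prob_def by (intro cSUP_least CPN success_prob_set_CPN m)
  moreover have "?PS ?CPE \<le> ?PS ?CPN"
    unfolding max_success_prob_def by (intro cSUP_subset_mono CPE bdd set_CPE_subset_CPN order_refl)
  moreover have "?PS ?C \<le> ?PS ?CPE"
    unfolding max_success_prob_def
    by (intro cSUP_subset_mono C bdd_above_mono[OF bdd] image_mono set_CPE_subset_CPN set_C_subset_CPE order_refl)
  ultimately show ?thesis
    unfolding Let_def m_def by (simp add: le_max_iff_disj)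
qed

end
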